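(* Fix patterns $\sigma_1\in S_{k_1},\dots,\sigma_d\in S_{k_d}$, let $K=k_1+\dots+k_d$, and let $\lambda$ be a partition. Then there is a polynomial $a^\lambda_{\sigma_1,\dots,\sigma_d}(n)$ in $n$ of degree at most $K-|\lambda|$ such that $\alpha^\lambda_{\sigma_1,\dots,\sigma_d,n}:=\langle\chi^{\lambda[n]},M_{\sigma_1,\dots,\sigma_d,n}\rangle=a^\lambda_{\sigma_1,\dots,\sigma_d}(n)$ for all $n\ge K+|\lambda|$ for which $\lambda[n]$ is a partition. In particular, if $|\lambda|>K$ this polynomial is zero, so the coefficient is zero for all such $n$.
   Context: For $\pi\in S_n$ and $\sigma\in S_k$, an occurrence of $\sigma$ in $\pi$ is a sequence $i_1<\dots<i_k$ in $[n]$ such that $\pi(i_a)>\pi(i_b)$ iff $\sigma(a)>\sigma(b)$; $N_\sigma(\pi)$ is the number of occurrences. $M_{\sigma_1,\dots,\sigma_d,n}(\pi)=\frac1{|C_\pi|}\sum_{\pi'\in C_\pi}N_{\sigma_1}(\pi')\cdots N_{\sigma_d}(\pi')$ with $C_\pi$ the conjugacy class of $\pi$ in $S_n$. For class functions on $S_n$, $\langle f,g\rangle=\frac1{n!}\sum_{\pi\in S_n}f(\pi)\overline{g(\pi)}$; $\chi^\mu$ is the irreducible character of $S_n$ indexed by the partition $\mu\vdash n$. For $\lambda=(\lambda_1\ge\dots\ge\lambda_i)$, $\lambda[n]=(n-|\lambda|,\lambda_1,\dots,\lambda_i)$, a partition of $n$ when $n-|\lambda|\ge\lambda_1$. *)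

theory Defs
  imports
    Complex_Main
    "HOL-Library.FuncSet"
    "HOL-Library.Function_Algebras"
    "HOL-Combinatorics.Permutations"
    "HOL-Computational_Algebra.Polynomial"
begin

abbreviation Sym :: "nat \<Rightarrow> (nat \<Rightarrow> nat) set" where
  "Sym n \<equiv> {p. p permutes {1..n}}"


section \<open>Patterns and their averages over conjugacy classes\<close>

text \<open>An occurrence $i_1 < \dots < i_k$ is an extensional function on \<open>{1..k}\<close>.\<close>

definition occurrences :: "nat \<Rightarrow> (nat \<Rightarrow> nat) \<Rightarrow> nat \<Rightarrow> (nat \<Rightarrow> nat) \<Rightarrow> (nat \<Rightarrow> nat) set" where
  "occurrences k \<sigma> n \<pi> =
     {i \<in> {1..k} \<rightarrow>\<^sub>E {1..n}. strict_mono_on {1..k} i \<and>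
        (\<forall>a\<in>{1..k}. \<forall>b\<in>{1..k}. \<pi> (i a) > \<pi> (i b) \<longleftrightarrow> \<sigma> a > \<sigma> b)}"

definition num_occ :: "nat \<Rightarrow> (nat \<Rightarrow> nat) \<Rightarrow> nat \<Rightarrow> (nat \<Rightarrow> nat) \<Rightarrow> nat" where
  "num_occ k \<sigma> n \<pi> = card (occurrences k \<sigma> n \<pi>)"

definition conj_class :: "nat \<Rightarrow> (nat \<Rightarrow> nat) \<Rightarrow> (nat \<Rightarrow> nat) set" where
  "conj_class n \<pi> = {\<tau> \<circ> \<pi> \<circ> inv \<tau> | \<tau>. \<tau> \<in> Sym n}"

text \<open>The patterns are \<open>\<sigma> 1, \<dots>, \<sigma> d\<close> with \<open>\<sigma> j\<close> in the symmetric group on \<open>{1..k j}\<close>.\<close>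

definition pattern_avg ::
    "nat \<Rightarrow> (nat \<Rightarrow> nat) \<Rightarrow> (nat \<Rightarrow> nat \<Rightarrow> nat) \<Rightarrow> nat \<Rightarrow> (nat \<Rightarrow> nat) \<Rightarrow> complex" where
  "pattern_avg d k \<sigma> n \<pi> =
     (\<Sum>\<pi>'\<in>conj_class n \<pi>. \<Prod>j=1..d. of_nat (num_occ (k j) (\<sigma> j) n \<pi>'))
       / of_nat (card (conj_class n \<pi>))"

definition class_inner ::
    "nat \<Rightarrow> ((nat \<Rightarrow> nat) \<Rightarrow> complex) \<Rightarrow> ((nat \<Rightarrow> nat) \<Rightarrow> complex) \<Rightarrow> complex" where
  "class_inner n f g = (\<Sum>\<pi>\<in>Sym n. f \<pi> * cnj (g \<pi>)) / fact n"


section \<open>Partitions\<close>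

text \<open>Partitions are weakly decreasing lists; as usual, trailing zeros are permitted and
  immaterial.  This way \<open>pad_partition n lam\<close> is a partition of \<open>n\<close> exactly when
  \<open>|lam| \<le> n\<close> and the first part of \<open>lam\<close> (0 if \<open>lam\<close> is empty) is at most \<open>n - |lam|\<close>.\<close>

definition is_partition :: "nat list \<Rightarrow> bool" where
  "is_partition \<mu> \<longleftrightarrow> sorted_wrt (\<ge>) \<mu>"

definition is_partition_of :: "nat list \<Rightarrow> nat \<Rightarrow> bool" where
  "is_partition_of \<mu> n \<longleftrightarrow> is_partition \<mu> \<and> sum_list \<mu> = n"

definition pad_partition :: "nat \<Rightarrow> nat list \<Rightarrow> nat list" where
  "pad_partition n lam = (n - sum_list lam) # lam"


section \<open>Irreducible characters of the symmetric group\<close>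

definition (in vector_space) trace_on :: "'b set \<Rightarrow> ('b \<Rightarrow> 'b) \<Rightarrow> 'a" where
  "trace_on W f =
     (let B = (SOME B. independent B \<and> span B = W) in \<Sum>b\<in>B. representation B (f b) b)"

interpretation cfun: vector_space "\<lambda>(c::complex) (f::(nat \<Rightarrow> nat) \<Rightarrow> complex) x. c * f x"
  by unfold_locales (auto simp: fun_eq_iff algebra_simps)

text \<open>The group algebra $\mathbb{C}[S_n]$ consists of the functions supported on \<open>Sym n\<close>.\<close>

definition group_alg :: "nat \<Rightarrow> ((nat \<Rightarrow> nat) \<Rightarrow> complex) set" where
  "group_alg n = {f. \<forall>p. p \<notin> Sym n \<longrightarrow> f p = 0}"

definition single :: "(nat \<Rightarrow> nat) \<Rightarrow> (nat \<Rightarrow> nat) \<Rightarrow> complex" where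
  "single p = (\<lambda>q. if q = p then 1 else 0)"

definition conv :: "nat \<Rightarrow> ((nat \<Rightarrow> nat) \<Rightarrow> complex) \<Rightarrow> ((nat \<Rightarrow> nat) \<Rightarrow> complex)
    \<Rightarrow> (nat \<Rightarrow> nat) \<Rightarrow> complex" where
  "conv n f g = (\<lambda>p. if p \<in> Sym n then \<Sum>q\<in>Sym n. f q * g (inv q \<circ> p) else 0)"

text \<open>Row and column (both up to a fixed offset) of the entry \<open>x\<close> in the tableau of shape \<open>\<mu>\<close>
  that is filled row by row with \<open>1, \<dots>, |\<mu>|\<close>.\<close>

definition row_of :: "nat list \<Rightarrow> nat \<Rightarrow> nat" where
  "row_of \<mu> x = (LEAST i. x \<le> sum_list (take (Suc i) \<mu>))"

definition col_of :: "nat list \<Rightarrow> nat \<Rightarrow> nat" where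
  "col_of \<mu> x = x - sum_list (take (row_of \<mu> x) \<mu>)"

definition row_stab :: "nat list \<Rightarrow> (nat \<Rightarrow> nat) set" where
  "row_stab \<mu> = {p \<in> Sym (sum_list \<mu>). \<forall>x\<in>{1..sum_list \<mu>}. row_of \<mu> (p x) = row_of \<mu> x}"

definition col_stab :: "nat list \<Rightarrow> (nat \<Rightarrow> nat) set" where
  "col_stab \<mu> = {q \<in> Sym (sum_list \<mu>). \<forall>x\<in>{1..sum_list \<mu>}. col_of \<mu> (q x) = col_of \<mu> x}"

text \<open>The Specht module of shape \<open>\<mu>\<close> is the left ideal $\mathbb{C}[S_n]\,c_\mu$ generated by the
  Young symmetrizer $c_\mu = \sum_{p \in P_\mu} \sum_{q \in Q_\mu} \mathrm{sgn}(q)\, pq$, where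
  $n = |\mu|$; with this convention the shape $(n)$ gives the trivial character.\<close>

definition young_symmetrizer :: "nat list \<Rightarrow> (nat \<Rightarrow> nat) \<Rightarrow> complex" where
  "young_symmetrizer \<mu> =
     (\<Sum>p\<in>row_stab \<mu>. \<Sum>q\<in>col_stab \<mu>. (\<lambda>g. of_int (sign q) * single (p \<circ> q) g))"

definition specht :: "nat list \<Rightarrow> ((nat \<Rightarrow> nat) \<Rightarrow> complex) set" where
  "specht \<mu> = (\<lambda>f. conv (sum_list \<mu>) f (young_symmetrizer \<mu>)) ` group_alg (sum_list \<mu>)"

definition irr_char :: "nat list \<Rightarrow> (nat \<Rightarrow> nat) \<Rightarrow> complex" where
  "irr_char \<mu> \<pi> = cfun.trace_on (specht \<mu>) (conv (sum_list \<mu>) (single \<pi>))"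


section \<open>The multiplicities\<close>

definition alpha ::
    "nat list \<Rightarrow> nat \<Rightarrow> (nat \<Rightarrow> nat) \<Rightarrow> (nat \<Rightarrow> nat \<Rightarrow> nat) \<Rightarrow> nat \<Rightarrow> complex" where
  "alpha lam d k \<sigma> n = class_inner n (irr_char (pad_partition n lam)) (pattern_avg d k \<sigma> n)"

end

theory Submission
  imports Defs
begin

text \<open>
  Since characters are class functions, the multiplicity is the inner product of $\chi^{\lambda[n]}$
  with the product of the $N_{\sigma_j}$ itself. Grouping the tuples of occurrences by the relative
  order of their positions and values turns this product into a combination, independent of $n$, of
  numbers of embeddings of finite directed graphs $E$ with at most $K$ edges into the graph of $\pi$.
  Removing a source of $E$ expresses the count through smaller graphs, at the price of a factor linear
  in $n$ whenever an edge is lost. What remains are graphs of permutations $\gamma$ of $s \le K$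
  points, which contribute the trace of $\gamma$ on the $S_{n-s}$-invariants of the Specht module.

  For the shape $\lambda[n]$, these invariants are the image of a space of functions on words of length
  $s$ under antisymmetrization along columns. Neither the space nor the kernel depends on $n$ for
  $n \ge s + |\lambda|$, because a filling of $\lambda[n]$ with $n - s$ indistinguishable blanks either
  has two blanks in a column, so that it is annihilated, or has a blank in a column with a single box,
  which can be removed. For $s < |\lambda|$ there are more blanks than columns and the image is zero.
\<close>

text \<open>The obstacle is that the Specht modules of lam[n] for different n live in different
  group algebras, and that \<open>irr_char\<close> is a trace in an unspecified basis. No character
  formula is used. Instead the invariants for every n are written as images of one and the same
  space, the functions u on words, on which \<gamma> acts by u -> u(w \<circ> \<gamma>) whatever n
  is. Equality of the traces for n and n+1 then reduces to equality of two kernels in that space.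
  The bounds come out as follows. A factor linear in n appears only together with the loss of an
  edge, and a surviving permutation graph with s edges contributes a constant, which is zero for s <
  |lam|. Hence the degree is at most K - s, which is at most K - |lam| whenever the contribution is
  not zero. The threshold for n is K + |lam| because s is at most K, and |lam| bounds the first part
  of lam: from n = s + |lam| on, a filling of lam[n+1] has more blanks than columns of height above
  one.\<close>

declare One_nat_def [simp del]

section \<open>Traces on finite-dimensional subspaces\<close>

context vector_space
begin

text \<open>\<open>trace_on\<close> picks its basis by choice. A maximal independent subset of W
  shows that there is something to pick, and independence inside a finitely spanned space makes
  every such basis finite.\<close>

lemma finite_dim_trace_basis:
  assumes "subspace W" "W \<subseteq> span S" "finite S"
  defines "B \<equiv> (SOME B. independent B \<and> span B = W)"
  shows "independent B" "span B = W" "finite B"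
proof -
  obtain B0 where "B0 \<subseteq> W" "independent B0" "W \<subseteq> span B0"
    by (rule maximal_independent_subset)
  then have "independent B0 \<and> span B0 = W"
    using span_minimal[OF _ assms(1)] by blast
  then have *: "independent B \<and> span B = W"
    unfolding B_def by (rule someI)
  then show "independent B" "span B = W" by auto
  then have "B \<subseteq> span S" using assms(2) span_superset by blast
  then show "finite B" using independent_span_bound[OF assms(3)] * by blast
qed

text \<open>Expanding both sides in the chosen bases of W and V gives the same double sum of
  products of matrix entries. With two different subspaces allowed, this one identity serves to
  conjugate a character, to pass from the Specht module to its invariants, and to compare the
  invariants for two values of n.\<close>

lemma trace_on_commute:
  assumes W: "subspace W" "W \<subseteq> span S" "finite S"
    and V: "subspace V" "V \<subseteq> span S'" "finite S'"
    and f: "Vector_Spaces.linear scale scale f" "f ` W \<subseteq> V"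
    and g: "Vector_Spaces.linear scale scale g" "g ` V \<subseteq> W"
  shows "trace_on W (\<lambda>x. g (f x)) = trace_on V (\<lambda>x. f (g x))"
proof -
  define B where "B = (SOME B. independent B \<and> span B = W)"
  define C where "C = (SOME B. independent B \<and> span B = V)"
  note B = finite_dim_trace_basis[OF W, folded B_def]
  note C = finite_dim_trace_basis[OF V, folded C_def]
  have expand: "representation D (h (k b)) b = (\<Sum>c\<in>E. representation E (k b) c * representation D (h c) b)"
    if D: "independent D" and E: "independent E" "finite E"
      and h: "Vector_Spaces.linear scale scale h" "h ` span E \<subseteq> span D" and kb: "k b \<in> span E"
    for D E h k b
  proof -
    interpret h: Vector_Spaces.linear scale scale h by (rule h)
    have "h (k b) = h (\<Sum>c\<in>E. representation E (k b) c *s c)"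
      using sum_representation_eq[OF E(1) kb E(2) order_refl] by simp
    also have "\<dots> = (\<Sum>c\<in>E. representation E (k b) c *s h c)"
      by (simp add: h.sum h.scale)
    finally have eq: "h (k b) = (\<Sum>c\<in>E. representation E (k b) c *s h c)" .
    have in_span: "h c \<in> span D" if "c \<in> E" for c
      using h(2) that span_base by blast
    show ?thesis
      unfolding eq using in_span
      by (simp add: representation_sum[OF D] span_scale representation_scale[OF D])
  qed
  have "trace_on W (\<lambda>x. g (f x)) = (\<Sum>b\<in>B. representation B (g (f b)) b)"
    by (simp add: trace_on_def B_def Let_def)
  also have "\<dots> = (\<Sum>b\<in>B. \<Sum>c\<in>C. representation C (f b) c * representation B (g c) b)"
  proof (intro sum.cong refl expand)
    show "f b \<in> span C" if "b \<in> B" for b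
      using that B C f span_base by blast
  qed (use B C g in auto)
  also have "\<dots> = (\<Sum>c\<in>C. \<Sum>b\<in>B. representation B (g c) b * representation C (f b) c)"
    by (subst sum.swap) (simp add: mult.commute)
  also have "\<dots> = (\<Sum>c\<in>C. representation C (f (g c)) c)"
  proof (intro sum.cong refl expand[symmetric])
    show "g c \<in> span B" if "c \<in> C" for c
      using that B C g span_base by blast
  qed (use B C f in auto)
  also have "\<dots> = trace_on V (\<lambda>x. f (g x))"
    by (simp add: trace_on_def C_def Let_def)
  finally show ?thesis .
qed

lemma trace_on_cong:
  assumes "subspace W" "W \<subseteq> span S" "finite S" "\<And>x. x \<in> W \<Longrightarrow> f x = g x"
  shows "trace_on W f = trace_on W g"
  unfolding trace_on_def Let_def
  using finite_dim_trace_basis(2)[OF assms(1-3)] assms(4) span_base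
  by (intro sum.cong refl) fastforce

lemma trace_on_scale_sum:
  assumes "subspace W" "W \<subseteq> span S" "finite S" "\<And>i x. i \<in> I \<Longrightarrow> x \<in> W \<Longrightarrow> f i x \<in> W"
  shows "trace_on W (\<lambda>x. c *s (\<Sum>i\<in>I. f i x)) = c * (\<Sum>i\<in>I. trace_on W (f i))"
proof -
  define B where "B = (SOME B. independent B \<and> span B = W)"
  note B = finite_dim_trace_basis[OF assms(1-3), folded B_def]
  have "representation B (c *s (\<Sum>i\<in>I. f i b)) b = c * (\<Sum>i\<in>I. representation B (f i b) b)"
    if "b \<in> B" for b
  proof -
    have "f i b \<in> span B" if "i \<in> I" for i
      using assms(4) that B(2) span_base[OF \<open>b \<in> B\<close>] by blast
    then show ?thesis
      by (simp add: representation_scale[OF B(1)] span_sum representation_sum[OF B(1)])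
  qed
  then show ?thesis
    unfolding trace_on_def Let_def B_def[symmetric]
    by (subst sum.swap) (simp add: sum_distrib_left)
qed

text \<open>The trace of an operator that is intertwined by \<open>p\<close> with \<open>D\<close> depends only on the kernel
  of \<open>p\<close>, because it is the trace of the operator induced by \<open>D\<close> modulo that kernel.\<close>

lemma trace_on_range_cong_ker:
  assumes p: "Vector_Spaces.linear scale scale p" and q: "Vector_Spaces.linear scale scale q"
    and T: "Vector_Spaces.linear scale scale T" and U: "Vector_Spaces.linear scale scale U"
    and ker: "\<And>x. p x = 0 \<longleftrightarrow> q x = 0"
    and Tp: "\<And>x. T (p x) = p (D x)" and Uq: "\<And>x. U (q x) = q (D x)"
    and fin: "range p \<subseteq> span S" "finite S" "range q \<subseteq> span S'" "finite S'"
  shows "trace_on (range p) T = trace_on (range q) U"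
proof -
  interpret vector_space_pair scale scale ..
  interpret p: Vector_Spaces.linear scale scale p by (rule p)
  interpret q: Vector_Spaces.linear scale scale q by (rule q)
  have sub: "subspace (range p)" "subspace (range q)"
    using p.subspace_image q.subspace_image subspace_UNIV by auto
  \<comment> \<open>Sections of p and q over their ranges. Two preimages of a vector differ by an
    element of the common kernel, so \<open>p \<circ> s\<close> and \<open>q \<circ> r\<close> are
    mutually inverse maps between the two ranges, and they transport U to T.\<close>
  obtain r where r: "Vector_Spaces.linear scale scale r" "\<And>v. v \<in> range p \<Longrightarrow> p (r v) = v"
    using linear_exists_right_inverse_on[OF p subspace_UNIV] by blast
  obtain s where s: "Vector_Spaces.linear scale scale s" "\<And>v. v \<in> range q \<Longrightarrow> q (s v) = v"
    using linear_exists_right_inverse_on[OF q subspace_UNIV] by blast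
  have psq: "p (s (q v)) = p v" for v
  proof -
    have "q (s (q v) - v) = 0" using s(2)[of "q v"] by (simp add: q.diff)
    then have "p (s (q v) - v) = 0" using ker by simp
    then show ?thesis by (simp add: p.diff)
  qed
  have qrp: "q (r (p v)) = q v" for v
  proof -
    have "p (r (p v) - v) = 0" using r(2)[of "p v"] by (simp add: p.diff)
    then have "q (r (p v) - v) = 0" using ker by simp
    then show ?thesis by (simp add: q.diff)
  qed
  have "trace_on (range p) T = trace_on (range p) (\<lambda>x. (p \<circ> s) ((U \<circ> (q \<circ> r)) x))"
    using sub(1) fin(1,2)
  proof (rule trace_on_cong)
    fix x assume "x \<in> range p"
    then have "T x = T (p (r x))" using r by simp
    also have "\<dots> = p (s (q (D (r x))))" by (simp add: Tp psq)
    finally show "T x = (p \<circ> s) ((U \<circ> (q \<circ> r)) x)" by (simp add: Uq)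
  qed
  also have "\<dots> = trace_on (range q) (\<lambda>x. (U \<circ> (q \<circ> r)) ((p \<circ> s) x))"
  proof (rule trace_on_commute[OF sub(1) fin(1,2) sub(2) fin(3,4)])
    show "Vector_Spaces.linear scale scale (U \<circ> (q \<circ> r))"
      "Vector_Spaces.linear scale scale (p \<circ> s)"
      by (rule Vector_Spaces.linear_compose[OF Vector_Spaces.linear_compose[OF r(1) q] U]
          Vector_Spaces.linear_compose[OF s(1) p])+
  qed (auto simp: Uq)
  also have "\<dots> = trace_on (range q) U"
    using sub(2) fin(3,4)
  proof (rule trace_on_cong)
    fix x assume "x \<in> range q"
    then show "(U \<circ> (q \<circ> r)) ((p \<circ> s) x) = U x" using qrp s by simp
  qed
  finally show ?thesis .
qed

end

section \<open>The left regular representation\<close>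

abbreviation clinear :: "(((nat \<Rightarrow> nat) \<Rightarrow> complex) \<Rightarrow> (nat \<Rightarrow> nat) \<Rightarrow> complex) \<Rightarrow> bool" where
  "clinear \<equiv> Vector_Spaces.linear (\<lambda>c f x. c * f x) (\<lambda>c f x. c * f x)"

lemma clinearI:
  assumes "\<And>f g x. h (\<lambda>y. f y + g y) x = h f x + h g x" "\<And>c f x. h (\<lambda>y. c * f y) x = c * h f x"
  shows "clinear h"
  unfolding Vector_Spaces.linear_def module_hom_def module_hom_axioms_def
  using assms cfun.vector_space_axioms cfun.module_axioms
  by (auto simp: fun_eq_iff plus_fun_def)

lemma finite_Sym: "finite (Sym n)"
  by (simp add: finite_permutations)

lemma Sym_compose: "p \<in> Sym n \<Longrightarrow> q \<in> Sym n \<Longrightarrow> p \<circ> q \<in> Sym n"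
  by (simp add: permutes_compose)

lemma Sym_inv: "p \<in> Sym n \<Longrightarrow> inv p \<in> Sym n"
  by (simp add: permutes_inv)

lemma Sym_inv_o: "p \<in> Sym n \<Longrightarrow> p \<circ> inv p = id" "p \<in> Sym n \<Longrightarrow> inv p \<circ> p = id"
  using permutes_inv_o by auto

lemma Sym_cancel:
  assumes "p \<in> Sym n"
  shows "inv p \<circ> (p \<circ> q) = q" "p \<circ> (inv p \<circ> q) = q"
    "(q \<circ> p) \<circ> inv p = q" "(q \<circ> inv p) \<circ> p = q"
  using Sym_inv_o[OF assms] by (auto simp: o_assoc[symmetric]) (simp_all add: o_assoc)

lemma Sym_inv_compose: "p \<in> Sym n \<Longrightarrow> q \<in> Sym n \<Longrightarrow> inv (p \<circ> q) = inv q \<circ> inv p"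
  by (auto intro: o_inv_distrib permutes_bij)

lemma Sym_inv_inv: "p \<in> Sym n \<Longrightarrow> inv (inv p) = p"
  by (auto intro: permutes_inv_inv)

lemma Sym_mono: "m \<le> n \<Longrightarrow> p \<in> Sym m \<Longrightarrow> p \<in> Sym n"
  by (auto intro: permutes_subset)

lemma sum_Sym_left:
  assumes "t \<in> Sym n" "\<And>p. p \<in> A \<Longrightarrow> p \<in> Sym n" "\<And>p. p \<in> Sym n \<Longrightarrow> t \<circ> p \<in> A \<longleftrightarrow> p \<in> B"
    "\<And>p. p \<in> B \<Longrightarrow> p \<in> Sym n"
  shows "sum f A = (\<Sum>p\<in>B. f (t \<circ> p))"
proof (rule sum.reindex_bij_witness[of _ "\<lambda>p. t \<circ> p" "\<lambda>p. inv t \<circ> p"])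
  fix p assume "p \<in> A"
  then show "inv t \<circ> p \<in> B"
    using assms(2) assms(3)[OF Sym_compose[OF Sym_inv[OF assms(1)]], of p] Sym_cancel[OF assms(1)]
    by auto
qed (use assms in \<open>auto simp: Sym_cancel[OF assms(1)]\<close>)

lemma conv_single:
  assumes "p \<in> Sym n"
  shows "conv n (single p) f = (\<lambda>x. if x \<in> Sym n then f (inv p \<circ> x) else 0)"
proof
  fix x
  have "(\<Sum>q\<in>Sym n. single p q * f (inv q \<circ> x)) = (\<Sum>q\<in>Sym n. if q = p then f (inv q \<circ> x) else 0)"
    by (intro sum.cong refl) (simp add: single_def)
  also have "\<dots> = f (inv p \<circ> x)"
    using assms by (subst sum.delta[OF finite_Sym]) simp
  finally show "conv n (single p) f x = (if x \<in> Sym n then f (inv p \<circ> x) else 0)"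
    by (simp add: conv_def)
qed

lemma clinear_conv_left: "clinear (\<lambda>f. conv n f g)"
  by (rule clinearI) (auto simp: conv_def algebra_simps sum.distrib sum_distrib_left)

lemma clinear_conv: "clinear (conv n f)"
  by (rule clinearI) (auto simp: conv_def algebra_simps sum.distrib sum_distrib_left)

lemma conv_in_group_alg: "conv n f g \<in> group_alg n"
  by (auto simp: conv_def group_alg_def)

text \<open>Left and right multiplication commute. This is the instance of associativity that makes
  the Specht module stable under left translation.\<close>

lemma conv_single_conv:
  assumes "p \<in> Sym n"
  shows "conv n (single p) (conv n f g) = conv n (conv n (single p) f) g"
proof
  fix x
  show "conv n (single p) (conv n f g) x = conv n (conv n (single p) f) g x"
  proof (cases "x \<in> Sym n")
    case True
    have "(\<Sum>q\<in>Sym n. f (inv p \<circ> q) * g (inv q \<circ> x)) = (\<Sum>q\<in>Sym n. f (inv p \<circ> (p \<circ> q)) * g (inv (p \<circ> q) \<circ> x))"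
      by (rule sum_Sym_left[OF assms]) (use assms Sym_compose in blast)+
    also have "\<dots> = (\<Sum>q\<in>Sym n. f q * g (inv q \<circ> (inv p \<circ> x)))"
      by (intro sum.cong refl) (simp only: Sym_inv_o[OF assms] id_o Sym_inv_compose[OF assms] o_assoc)
    finally show ?thesis
      using True Sym_compose[OF Sym_inv[OF assms] True]
      by (simp only: conv_single[OF assms]) (simp add: conv_def)
  qed (simp add: conv_single[OF assms], simp add: conv_def)
qed

lemma group_alg_subset_span: "group_alg n \<subseteq> cfun.span (single ` Sym n)"
proof
  fix f assume f: "f \<in> group_alg n"
  have "f = (\<Sum>p\<in>Sym n. (\<lambda>x. f p * single p x))"
  proof
    fix x
    have "(\<Sum>p\<in>Sym n. (\<lambda>x. f p * single p x)) x = (\<Sum>p\<in>Sym n. f p * single p x)"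
      by (induction rule: infinite_finite_induct) (auto simp: plus_fun_def zero_fun_def)
    also have "\<dots> = (\<Sum>p\<in>Sym n. if x = p then f p else 0)"
      by (intro sum.cong refl) (simp add: single_def)
    also have "\<dots> = f x"
      using f by (subst sum.delta'[OF finite_Sym]) (auto simp: group_alg_def)
    finally show "f x = (\<Sum>p\<in>Sym n. (\<lambda>x. f p * single p x)) x" by simp
  qed
  also have "\<dots> \<in> cfun.span (single ` Sym n)"
    by (intro cfun.span_sum cfun.span_scale cfun.span_base imageI)
  finally show "f \<in> cfun.span (single ` Sym n)" .
qed

lemma subspace_group_alg: "cfun.subspace (group_alg n)"
  by (auto simp: cfun.subspace_def group_alg_def plus_fun_def zero_fun_def)

lemma subspace_specht: "cfun.subspace (specht \<mu>)"
proof -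
  interpret Vector_Spaces.linear "\<lambda>c (f :: (nat \<Rightarrow> nat) \<Rightarrow> complex) x. c * f x"
    "\<lambda>c (f :: (nat \<Rightarrow> nat) \<Rightarrow> complex) x. c * f x" "\<lambda>f. conv (sum_list \<mu>) f (young_symmetrizer \<mu>)"
    by (rule clinear_conv_left)
  show ?thesis
    unfolding specht_def by (rule subspace_image[OF subspace_group_alg])
qed

lemma specht_subset_group_alg: "specht \<mu> \<subseteq> group_alg (sum_list \<mu>)"
  by (auto simp: specht_def conv_in_group_alg)

lemmas specht_finite_dim =
  subspace_specht specht_subset_group_alg[THEN subset_trans, OF group_alg_subset_span]
  finite_imageI[OF finite_Sym]

lemma conv_single_specht:
  assumes "p \<in> Sym (sum_list \<mu>)" "f \<in> specht \<mu>"
  shows "conv (sum_list \<mu>) (single p) f \<in> specht \<mu>"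
  using assms by (auto simp: specht_def conv_single_conv conv_in_group_alg)

lemma conv_single_single:
  assumes "p \<in> Sym n" "q \<in> Sym n"
  shows "conv n (single p) (conv n (single q) f) = conv n (single (p \<circ> q)) f"
proof
  fix x
  show "conv n (single p) (conv n (single q) f) x = conv n (single (p \<circ> q)) f x"
    unfolding conv_single[OF assms(1)] conv_single[OF assms(2)] conv_single[OF Sym_compose[OF assms]]
    using Sym_compose[OF Sym_inv[OF assms(1)], of x] by (auto simp: Sym_inv_compose[OF assms] o_assoc)
qed

text \<open>Left translations by t p and by the inverse of t, multiplied in the two possible orders,
  give translation by the conjugate of p and by p itself. Commuting them under the trace is all that
  is needed.\<close>

lemma irr_char_conj:
  assumes "t \<in> Sym (sum_list \<mu>)" "p \<in> Sym (sum_list \<mu>)"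
  shows "irr_char \<mu> (t \<circ> p \<circ> inv t) = irr_char \<mu> p"
proof -
  define n where "n = sum_list \<mu>"
  define L where "L = (\<lambda>p. conv n (single p))"
  have t: "t \<in> Sym n" "inv t \<in> Sym n" and p: "p \<in> Sym n"
    using assms Sym_inv by (auto simp: n_def)
  have lin: "clinear (L q)" for q
    unfolding L_def by (rule clinear_conv)
  have im: "L q ` specht \<mu> \<subseteq> specht \<mu>" if "q \<in> Sym n" for q
    using conv_single_specht that unfolding L_def n_def by blast
  have L: "L q (L r f) = L (q \<circ> r) f" if "q \<in> Sym n" "r \<in> Sym n" for q r f
    unfolding L_def using that by (rule conv_single_single)
  have "irr_char \<mu> (t \<circ> p \<circ> inv t) = cfun.trace_on (specht \<mu>) (\<lambda>f. L (t \<circ> p) (L (inv t) f))"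
    unfolding irr_char_def n_def[symmetric]
    by (simp add: L_def[THEN fun_cong, symmetric] L[OF Sym_compose[OF t(1) p] t(2)])
  also have "\<dots> = cfun.trace_on (specht \<mu>) (\<lambda>f. L (inv t) (L (t \<circ> p) f))"
    by (intro cfun.trace_on_commute[OF specht_finite_dim specht_finite_dim,
            where f = "L (inv t)" and g = "L (t \<circ> p)"] lin im t Sym_compose p)
  also have "\<dots> = irr_char \<mu> p"
    unfolding irr_char_def n_def[symmetric]
    by (simp add: L_def[THEN fun_cong, symmetric] L[OF t(2) Sym_compose[OF t(1) p]] Sym_cancel[OF t(1)])
  finally show ?thesis .
qed

section \<open>Invariants of the Specht module\<close>

lemma sum_fun_apply: "(\<Sum>i\<in>A. f i) x = (\<Sum>i\<in>A. f i x)"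
  by (induction A rule: infinite_finite_induct) (auto simp: zero_fun_def)

lemma row_stab_iff: "p \<in> row_stab \<mu> \<longleftrightarrow> p \<in> Sym (sum_list \<mu>) \<and> (\<forall>x. row_of \<mu> (p x) = row_of \<mu> x)"
  unfolding row_stab_def by (auto simp: permutes_def)

lemma col_stab_iff: "p \<in> col_stab \<mu> \<longleftrightarrow> p \<in> Sym (sum_list \<mu>) \<and> (\<forall>x. col_of \<mu> (p x) = col_of \<mu> x)"
  unfolding col_stab_def by (auto simp: permutes_def)

lemma inv_preserves:
  assumes "p \<in> Sym n" "\<And>x. r (p x) = r x"
  shows "r (inv p x) = r x"
  using assms(1) assms(2)[of "inv p x"] by (simp add: permutes_inverses)

lemma finite_row_stab: "finite (row_stab \<mu>)"
  by (auto simp: row_stab_def finite_Sym intro: finite_subset[OF _ finite_Sym])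

lemma row_stab_group:
  "id \<in> row_stab \<mu>"
  "p \<in> row_stab \<mu> \<Longrightarrow> inv p \<in> row_stab \<mu>"
  "p \<in> row_stab \<mu> \<Longrightarrow> q \<in> Sym (sum_list \<mu>) \<Longrightarrow> p \<circ> q \<in> row_stab \<mu> \<longleftrightarrow> q \<in> row_stab \<mu>"
  using Sym_compose Sym_inv inv_preserves[of p "sum_list \<mu>" "row_of \<mu>"]
  by (auto simp: row_stab_iff permutes_id)

lemma col_stab_group:
  "id \<in> col_stab \<mu>"
  "p \<in> col_stab \<mu> \<Longrightarrow> inv p \<in> col_stab \<mu>"
  "p \<in> col_stab \<mu> \<Longrightarrow> q \<in> Sym (sum_list \<mu>) \<Longrightarrow> p \<circ> q \<in> col_stab \<mu> \<longleftrightarrow> q \<in> col_stab \<mu>"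
  using Sym_compose Sym_inv inv_preserves[of p "sum_list \<mu>" "col_of \<mu>"]
  by (auto simp: col_stab_iff permutes_id)

lemma sign_Sym_inv: "p \<in> Sym n \<Longrightarrow> sign (inv p) = sign p"
  by (auto intro: sign_inverse permutes_imp_permutation[of "{1..n}"])

lemma sign_Sym_compose: "p \<in> Sym n \<Longrightarrow> q \<in> Sym n \<Longrightarrow> sign (p \<circ> q) = sign p * sign q"
  by (auto intro!: sign_compose permutes_imp_permutation[of "{1..n}"])

text \<open>Right multiplication by the Young symmetrizer evaluates f at x (pq)^-1; replacing p and
  q by their inverses, which preserves the stabilizers and the sign, yields a sum over row
  permutations inside an antisymmetrization over column permutations. The inner sum is invariant
  under row permutations, which is why only rows of labels matter later.\<close>

lemma conv_young_symmetrizer: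
  assumes "x \<in> Sym (sum_list \<mu>)"
  shows "conv (sum_list \<mu>) f (young_symmetrizer \<mu>) x =
    (\<Sum>q\<in>col_stab \<mu>. of_int (sign q) * (\<Sum>p\<in>row_stab \<mu>. f (x \<circ> q \<circ> p)))"
proof -
  let ?n = "sum_list \<mu>" and ?P = "row_stab \<mu>" and ?Q = "col_stab \<mu>"
  have P: "p \<in> Sym ?n" if "p \<in> ?P" for p using that by (simp add: row_stab_iff)
  have Q: "q \<in> Sym ?n" if "q \<in> ?Q" for q using that by (simp add: col_stab_iff)
  have *: "(\<Sum>g\<in>Sym ?n. f g * (of_int (sign q) * single (p \<circ> q) (inv g \<circ> x)))
      = of_int (sign q) * f (x \<circ> inv q \<circ> inv p)" if "p \<in> ?P" "q \<in> ?Q" for p q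
  proof -
    have pq: "p \<circ> q \<in> Sym ?n" using Sym_compose P Q that by blast
    then have y: "x \<circ> inv (p \<circ> q) \<in> Sym ?n" using Sym_compose Sym_inv assms by blast
    have "inv g \<circ> x = p \<circ> q \<longleftrightarrow> g = x \<circ> inv (p \<circ> q)" if "g \<in> Sym ?n" for g
    proof
      assume "inv g \<circ> x = p \<circ> q"
      then have "g \<circ> (p \<circ> q) = x" using Sym_cancel(2)[OF that, of x] by simp
      then show "g = x \<circ> inv (p \<circ> q)" using Sym_cancel(3)[OF pq, of g] by simp
    next
      assume g: "g = x \<circ> inv (p \<circ> q)"
      then have "g \<circ> (p \<circ> q) = x" using Sym_cancel(4)[OF pq, of x] by simp
      then show "inv g \<circ> x = p \<circ> q" using Sym_cancel(1)[OF that, of "p \<circ> q"] by simp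
    qed
    then have "(\<Sum>g\<in>Sym ?n. f g * (of_int (sign q) * single (p \<circ> q) (inv g \<circ> x)))
        = (\<Sum>g\<in>Sym ?n. if g = x \<circ> inv (p \<circ> q) then f g * of_int (sign q) else 0)"
      by (intro sum.cong refl) (simp add: single_def)
    also have "\<dots> = f (x \<circ> inv (p \<circ> q)) * of_int (sign q)"
      using y by (subst sum.delta[OF finite_Sym]) simp
    finally show ?thesis
      using that by (simp add: Sym_inv_compose[OF P Q] o_assoc mult.commute)
  qed
  have "conv ?n f (young_symmetrizer \<mu>) x
      = (\<Sum>g\<in>Sym ?n. \<Sum>p\<in>?P. \<Sum>q\<in>?Q. f g * (of_int (sign q) * single (p \<circ> q) (inv g \<circ> x)))"
    using assms by (simp add: conv_def young_symmetrizer_def sum_fun_apply sum_distrib_left)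
  also have "\<dots> = (\<Sum>p\<in>?P. \<Sum>q\<in>?Q. \<Sum>g\<in>Sym ?n. f g * (of_int (sign q) * single (p \<circ> q) (inv g \<circ> x)))"
    by (subst sum.swap) (intro sum.cong refl sum.swap)
  also have "\<dots> = (\<Sum>p\<in>?P. \<Sum>q\<in>?Q. of_int (sign q) * f (x \<circ> inv q \<circ> inv p))"
    by (intro sum.cong refl *)
  also have "\<dots> = (\<Sum>q\<in>?Q. \<Sum>p\<in>?P. of_int (sign q) * f (x \<circ> inv q \<circ> inv p))"
    by (rule sum.swap)
  also have "\<dots> = (\<Sum>q\<in>?Q. \<Sum>p\<in>?P. of_int (sign q) * f (x \<circ> q \<circ> inv p))"
    by (rule sum.reindex_bij_witness[of _ inv inv])
       (simp_all add: col_stab_group Sym_inv_inv[OF Q] sign_Sym_inv[OF Q])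
  also have "\<dots> = (\<Sum>q\<in>?Q. of_int (sign q) * (\<Sum>p\<in>?P. f (x \<circ> q \<circ> inv p)))"
    by (simp add: sum_distrib_left)
  also have "\<dots> = (\<Sum>q\<in>?Q. of_int (sign q) * (\<Sum>p\<in>?P. f (x \<circ> q \<circ> p)))"
  proof -
    have "(\<Sum>p\<in>?P. f (x \<circ> q \<circ> inv p)) = (\<Sum>p\<in>?P. f (x \<circ> q \<circ> p))" for q
      by (rule sum.reindex_bij_witness[of _ inv inv])
        (simp_all add: row_stab_group Sym_inv_inv[OF P])
    then show ?thesis by simp
  qed
  finally show ?thesis .
qed

text \<open>A permutation \<open>\<Psi>\<close> is seen as the filling that puts the label \<open>\<Psi> x\<close> into the box \<open>x\<close>; only the
  rows of the labels \<open>1, \<dots>, s\<close> are recorded.\<close>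

definition row_word :: "nat list \<Rightarrow> nat \<Rightarrow> (nat \<Rightarrow> nat) \<Rightarrow> nat \<Rightarrow> nat" where
  "row_word \<mu> s \<Psi> = (\<lambda>x. if x \<in> {1..s} then row_of \<mu> (inv \<Psi> x) else 0)"

text \<open>Up to the order of the row stabilizer this is right multiplication by the Young
  symmetrizer, applied to the function sending \<Psi> to u of its row word. The argument u is a
  function on all of nat => nat, not just on the words that occur for \<mu>, so that the maps for
  different shapes share their domain and their kernels can be compared.\<close>

definition col_antisym :: "nat list \<Rightarrow> nat \<Rightarrow> ((nat \<Rightarrow> nat) \<Rightarrow> complex) \<Rightarrow> (nat \<Rightarrow> nat) \<Rightarrow> complex" where
  "col_antisym \<mu> s u = (\<lambda>\<Phi>. if \<Phi> \<in> Sym (sum_list \<mu>)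
     then \<Sum>q\<in>col_stab \<mu>. of_int (sign q) * u (row_word \<mu> s (\<Phi> \<circ> q)) else 0)"

definition extensions :: "nat \<Rightarrow> nat \<Rightarrow> (nat \<Rightarrow> nat) \<Rightarrow> (nat \<Rightarrow> nat) set" where
  "extensions n s \<gamma> = {\<pi> \<in> Sym n. \<forall>x\<in>{1..s}. \<pi> x = \<gamma> x}"

text \<open>For \<gamma> in Sym s with s at most n, the extensions form a coset of the group of
  permutations of {s+1..n}, of size (n - s)!. Averaging over it is the projection onto the
  invariants of that group followed by \<gamma>.\<close>

definition ext_avg :: "nat \<Rightarrow> nat \<Rightarrow> (nat \<Rightarrow> nat) \<Rightarrow> ((nat \<Rightarrow> nat) \<Rightarrow> complex) \<Rightarrow> (nat \<Rightarrow> nat) \<Rightarrow> complex" where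
  "ext_avg n s \<gamma> f = (\<lambda>x. 1 / fact (n - s) * (\<Sum>\<pi>\<in>extensions n s \<gamma>. conv n (single \<pi>) f) x)"

lemma clinear_col_antisym: "clinear (col_antisym \<mu> s)"
  by (rule clinearI) (auto simp: col_antisym_def algebra_simps sum.distrib sum_distrib_left)

lemma clinear_ext_avg: "clinear (ext_avg n s \<gamma>)"
proof (rule clinearI)
  interpret c: Vector_Spaces.linear "\<lambda>c (f :: (nat \<Rightarrow> nat) \<Rightarrow> complex) x. c * f x"
    "\<lambda>c (f :: (nat \<Rightarrow> nat) \<Rightarrow> complex) x. c * f x" "conv n (single p)" for p
    by (rule clinear_conv)
  fix f g :: "(nat \<Rightarrow> nat) \<Rightarrow> complex" and c x
  have "(\<lambda>y. f y + g y) = f + g" by (simp add: plus_fun_def)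
  then show "ext_avg n s \<gamma> (\<lambda>y. f y + g y) x = ext_avg n s \<gamma> f x + ext_avg n s \<gamma> g x"
    by (simp add: ext_avg_def sum_fun_apply c.add sum.distrib algebra_simps)
  show "ext_avg n s \<gamma> (\<lambda>y. c * f y) x = c * ext_avg n s \<gamma> f x"
    by (simp add: ext_avg_def sum_fun_apply c.scale sum_distrib_left algebra_simps)
qed

lemma card_extensions:
  assumes "\<gamma> \<in> Sym s" "s \<le> n"
  shows "card (extensions n s \<gamma>) = fact (n - s)"
proof -
  have g: "\<gamma> \<in> Sym n" using Sym_mono[OF assms(2,1)] .
  have "bij_betw (\<lambda>p. \<gamma> \<circ> p) {p. p permutes {s+1..n}} (extensions n s \<gamma>)"
  proof (rule bij_betw_byWitness[where f' = "\<lambda>p. inv \<gamma> \<circ> p"])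
    show "(\<lambda>p. \<gamma> \<circ> p) ` {p. p permutes {s+1..n}} \<subseteq> extensions n s \<gamma>"
    proof (intro image_subsetI)
      fix p assume "p \<in> {p. p permutes {s+1..n}}"
      then have p: "p permutes {s+1..n}" by simp
      then have "p \<in> Sym n" using permutes_subset[OF p, of "{1..n}"] by simp
      then have "\<gamma> \<circ> p \<in> Sym n" by (rule Sym_compose[OF g])
      moreover have "p x = x" if "x \<in> {1..s}" for x
        using permutes_not_in[OF p, of x] that by simp
      ultimately show "\<gamma> \<circ> p \<in> extensions n s \<gamma>"
        by (simp add: extensions_def)
    qed
    show "(\<lambda>p. inv \<gamma> \<circ> p) ` extensions n s \<gamma> \<subseteq> {p. p permutes {s+1..n}}"
    proof (intro image_subsetI CollectI)
      fix p assume p: "p \<in> extensions n s \<gamma>"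
      show "inv \<gamma> \<circ> p permutes {s+1..n}"
      proof (rule permutes_superset)
        show "inv \<gamma> \<circ> p permutes {1..n}"
          using p Sym_compose[OF Sym_inv[OF g], of p] by (simp add: extensions_def)
        fix x assume x: "x \<in> {1..n} - {s+1..n}"
        then have "x \<in> {1..s}" by auto
        then have "p x = \<gamma> x" using p by (simp add: extensions_def)
        then show "(inv \<gamma> \<circ> p) x = x" using assms(1) by (simp add: permutes_inverses)
      qed
    qed
  qed (simp_all add: Sym_cancel[OF g])
  then have "card (extensions n s \<gamma>) = card {p. p permutes {s+1..n}}"
    by (simp add: bij_betw_same_card)
  also have "\<dots> = fact (n - s)" by (rule card_permutations) auto
  finally show ?thesis .
qed

text \<open>The label x sits in the filling \<open>inv \<pi> \<circ> \<Psi>\<close> where \<pi> x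
  sat in \<Psi>, and on the recorded labels \<pi> agrees with \<gamma>. So every extension of
  \<gamma> acts on words in the same way, by precomposition with \<gamma>.\<close>

lemma row_word_left:
  assumes "\<gamma> \<in> Sym s" "\<pi> \<in> extensions n s \<gamma>" "\<Psi> \<in> Sym n"
  shows "row_word \<mu> s (inv \<pi> \<circ> \<Psi>) = row_word \<mu> s \<Psi> \<circ> \<gamma>"
proof
  fix x
  have p: "\<pi> \<in> Sym n" using assms(2) by (simp add: extensions_def)
  have "\<gamma> x \<in> {1..s} \<longleftrightarrow> x \<in> {1..s}" using permutes_in_image[of \<gamma> "{1..s}" x] assms(1) by simp
  moreover have "inv (inv \<pi> \<circ> \<Psi>) x = inv \<Psi> (\<pi> x)"
    by (simp add: Sym_inv_compose[OF Sym_inv[OF p] assms(3)] Sym_inv_inv[OF p])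
  moreover have "\<pi> x = \<gamma> x" if "x \<in> {1..s}"
    using assms(2) that by (simp add: extensions_def)
  ultimately show "row_word \<mu> s (inv \<pi> \<circ> \<Psi>) x = (row_word \<mu> s \<Psi> \<circ> \<gamma>) x"
    by (simp add: row_word_def)
qed

lemma row_word_right:
  assumes "p \<in> row_stab \<mu>" "\<Psi> \<in> Sym (sum_list \<mu>)"
  shows "row_word \<mu> s (\<Psi> \<circ> p) = row_word \<mu> s \<Psi>"
proof -
  have p: "p \<in> Sym (sum_list \<mu>)" "\<And>x. row_of \<mu> (p x) = row_of \<mu> x" using assms(1) by (auto simp: row_stab_iff)
  show ?thesis
    by (simp add: fun_eq_iff row_word_def Sym_inv_compose[OF assms(2) p(1)] inv_preserves[where r = "row_of \<mu>", OF p])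
qed

text \<open>The row word determines the double coset of a filling under permutations of the blanks
  on the left and row permutations on the right. Each row has a fixed number of boxes and, in both
  fillings, holds the same recorded labels; hence it holds equally many blanks, and some permutation
  of the blanks matches the rows.\<close>

lemma row_word_eqE:
  assumes "\<Psi> \<in> Sym (sum_list \<mu>)" "\<Psi>' \<in> Sym (sum_list \<mu>)" "s \<le> sum_list \<mu>"
    and eq: "row_word \<mu> s \<Psi> = row_word \<mu> s \<Psi>'"
  obtains \<tau> p where "\<tau> \<in> extensions (sum_list \<mu>) s id" "p \<in> row_stab \<mu>" "\<Psi>' = \<tau> \<circ> \<Psi> \<circ> p"
proof -
  let ?n = "sum_list \<mu>"
  define A where "A = {s+1..?n}"
  define f where "f = (\<lambda>\<Psi>. row_of \<mu> \<circ> inv \<Psi> :: nat \<Rightarrow> nat)"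
  have A: "mset_set {1..?n} = mset_set {1..s} + mset_set A"
    using assms(3) unfolding A_def by (subst mset_set_Union[symmetric]) (auto intro: arg_cong[where f = mset_set])
  have f: "image_mset (f \<Phi>) (mset_set {1..?n}) = image_mset (row_of \<mu>) (mset_set {1..?n})" if "\<Phi> \<in> Sym ?n" for \<Phi>
    using permutes_image_mset[of "inv \<Phi>" "{1..?n}"] Sym_inv[OF that]
    by (simp add: f_def multiset.map_comp[symmetric])
  have on_s: "f \<Psi> x = f \<Psi>' x" if "x \<in> {1..s}" for x
    using fun_cong[OF eq, of x] that by (simp add: row_word_def f_def)
  then have "image_mset (f \<Psi>) (mset_set {1..s}) = image_mset (f \<Psi>') (mset_set {1..s})"
    by (intro image_mset_cong) auto
  moreover have "image_mset (f \<Psi>) (mset_set {1..s}) + image_mset (f \<Psi>) (mset_set A)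
      = image_mset (f \<Psi>') (mset_set {1..s}) + image_mset (f \<Psi>') (mset_set A)"
    unfolding image_mset_union[symmetric] A[symmetric] by (simp only: f[OF assms(1)] f[OF assms(2)])
  ultimately have "image_mset (f \<Psi>) (mset_set A) = image_mset (f \<Psi>') (mset_set A)"
    by simp
  then obtain t where t: "t permutes A" "\<forall>x\<in>A. f \<Psi> x = f \<Psi>' (t x)"
    using image_mset_eq_implies_permutes[of A] unfolding A_def by blast
  have tn: "t \<in> Sym ?n" using permutes_subset[OF t(1), of "{1..?n}"] by (auto simp: A_def)
  have t_id: "t x = x" if "x \<notin> A" for x using permutes_not_in[OF t(1) that] .
  have ft: "f \<Psi> x = f \<Psi>' (t x)" if "x \<in> {1..?n}" for x
    using t on_s[of x] t_id[of x] that assms(3) by (cases "x \<in> A") (auto simp: A_def)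
  \<comment> \<open>Once t has matched the rows of all labels, the remaining difference between the
    fillings keeps every box in its row.\<close>
  define p where "p = inv \<Psi> \<circ> (inv t \<circ> \<Psi>')"
  have p: "p \<in> Sym ?n" unfolding p_def using assms tn by (intro Sym_compose Sym_inv)
  have "row_of \<mu> (p y) = row_of \<mu> y" for y
  proof (cases "y \<in> {1..?n}")
    case True
    define x where "x = inv t (\<Psi>' y)"
    have "x \<in> {1..?n}"
      using True assms(2) Sym_inv[OF tn] unfolding x_def by (metis mem_Collect_eq permutes_in_image)
    from ft[OF this] have "row_of \<mu> (inv \<Psi> x) = row_of \<mu> (inv \<Psi>' (t x))" by (simp add: f_def)
    also have "t x = \<Psi>' y" using tn by (simp add: x_def permutes_inverses)
    also have "inv \<Psi>' (\<Psi>' y) = y" using assms(2) by (simp add: permutes_inverses)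
    finally show ?thesis by (simp add: p_def x_def)
  qed (use permutes_not_in[of p] p in simp)
  then have "p \<in> row_stab \<mu>" using p by (simp add: row_stab_iff)
  moreover have "\<Psi>' = t \<circ> \<Psi> \<circ> p"
    unfolding p_def by (simp add: Sym_cancel[OF assms(1)] Sym_cancel[OF tn] o_assoc[symmetric])
  moreover have "t \<in> extensions ?n s id"
    using tn t_id by (auto simp: extensions_def A_def)
  ultimately show thesis using that by blast
qed

lemma ext_avg_apply:
  assumes "x \<in> Sym n"
  shows "ext_avg n s \<gamma> f x = (\<Sum>\<pi>\<in>extensions n s \<gamma>. f (inv \<pi> \<circ> x)) / fact (n - s)"
proof -
  have "conv n (single \<pi>) f x = f (inv \<pi> \<circ> x)" if "\<pi> \<in> extensions n s \<gamma>" for \<pi>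
    using conv_single[of \<pi> n f] that assms by (simp add: extensions_def)
  then show ?thesis by (simp add: ext_avg_def sum_fun_apply)
qed

lemma ext_avg_outside:
  assumes "x \<notin> Sym n"
  shows "ext_avg n s \<gamma> f x = 0"
  using assms by (simp add: ext_avg_def sum_fun_apply conv_def)

text \<open>All extensions of \<gamma> have the same effect on words, so the average is harmless
  here. The resulting operator on u mentions neither the shape nor n; it is the operator
  \<open>D\<close> in the application of \<open>trace_on_range_cong_ker\<close>.\<close>

lemma ext_avg_col_antisym:
  assumes "\<gamma> \<in> Sym s" "s \<le> sum_list \<mu>"
  shows "ext_avg (sum_list \<mu>) s \<gamma> (col_antisym \<mu> s u) = col_antisym \<mu> s (\<lambda>w. u (w \<circ> \<gamma>))"
proof
  let ?n = "sum_list \<mu>"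
  fix x
  show "ext_avg ?n s \<gamma> (col_antisym \<mu> s u) x = col_antisym \<mu> s (\<lambda>w. u (w \<circ> \<gamma>)) x"
  proof (cases "x \<in> Sym ?n")
    case True
    have "col_antisym \<mu> s u (inv \<pi> \<circ> x) = col_antisym \<mu> s (\<lambda>w. u (w \<circ> \<gamma>)) x"
      if "\<pi> \<in> extensions ?n s \<gamma>" for \<pi>
    proof -
      have "\<pi> \<in> Sym ?n" using that by (simp add: extensions_def)
      then have "inv \<pi> \<circ> x \<in> Sym ?n" using Sym_compose[OF Sym_inv True] by blast
      moreover have "row_word \<mu> s (inv \<pi> \<circ> x \<circ> q) = row_word \<mu> s (x \<circ> q) \<circ> \<gamma>" if "q \<in> col_stab \<mu>" for q
        using row_word_left[OF assms(1) \<open>\<pi> \<in> extensions ?n s \<gamma>\<close> Sym_compose[OF True, of q]] that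
        by (simp add: col_stab_iff o_assoc)
      ultimately show ?thesis using True by (simp add: col_antisym_def)
    qed
    then show ?thesis
      using True by (simp add: ext_avg_apply card_extensions[OF assms])
  qed (simp add: ext_avg_outside, simp add: col_antisym_def)
qed

lemma col_antisym_in_specht: "col_antisym \<mu> s u \<in> specht \<mu>"
proof -
  let ?n = "sum_list \<mu>" and ?P = "row_stab \<mu>"
  \<comment> \<open>The division compensates for the sum over the row stabilizer in
    \<open>conv_young_symmetrizer\<close>, all of whose terms are equal for this f.\<close>
  define f where "f = (\<lambda>\<Psi>. if \<Psi> \<in> Sym ?n then u (row_word \<mu> s \<Psi>) / of_nat (card ?P) else 0)"
  have "card ?P \<noteq> 0" using row_stab_group(1) finite_row_stab by (auto simp: card_eq_0_iff)
  have "conv ?n f (young_symmetrizer \<mu>) x = col_antisym \<mu> s u x" for x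
  proof (cases "x \<in> Sym ?n")
    case True
    have "f (x \<circ> q \<circ> p) = u (row_word \<mu> s (x \<circ> q)) / of_nat (card ?P)"
      if "q \<in> col_stab \<mu>" "p \<in> ?P" for p q
    proof -
      have "x \<circ> q \<in> Sym ?n" using that Sym_compose[OF True] by (simp add: col_stab_iff)
      moreover then have "x \<circ> q \<circ> p \<in> Sym ?n" using that Sym_compose[of "x \<circ> q"] by (simp add: row_stab_iff)
      ultimately show ?thesis by (simp add: f_def row_word_right[OF that(2)])
    qed
    then show ?thesis
      using True \<open>card ?P \<noteq> 0\<close> by (simp add: conv_young_symmetrizer col_antisym_def)
  qed (simp add: conv_def, simp add: col_antisym_def)
  moreover have "f \<in> group_alg ?n" by (simp add: f_def group_alg_def)
  ultimately show ?thesis unfolding specht_def by (intro image_eqI[of _ _ f]) auto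
qed

text \<open>Averaging over the blanks on the left together with the row sum on the right turns the
  given g into a function h constant on double cosets. By \<open>row_word_eqE\<close> such a
  function factors through the row word, and what is left of the Young symmetrizer is the column
  antisymmetrization.\<close>

lemma ext_avg_specht:
  assumes "\<gamma> \<in> Sym s" "s \<le> sum_list \<mu>" "f \<in> specht \<mu>"
  shows "ext_avg (sum_list \<mu>) s \<gamma> f \<in> range (col_antisym \<mu> s)"
proof -
  let ?n = "sum_list \<mu>" and ?P = "row_stab \<mu>" and ?Q = "col_stab \<mu>" and ?E = "extensions (sum_list \<mu>) s \<gamma>"
  obtain g where f: "f = conv ?n g (young_symmetrizer \<mu>)"
    using assms(3) by (auto simp: specht_def)
  define h where "h = (\<lambda>\<Psi>. (\<Sum>\<pi>\<in>?E. \<Sum>p\<in>?P. g (inv \<pi> \<circ> \<Psi> \<circ> p)) / fact (?n - s))"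
  have h_inv: "h (\<tau> \<circ> \<Psi> \<circ> p') = h \<Psi>" if tau: "\<tau> \<in> extensions ?n s id" and p': "p' \<in> ?P" for \<tau> \<Psi> p'
  proof -
    have t: "\<tau> \<in> Sym ?n" using tau by (simp add: extensions_def)
    have p'n: "p' \<in> Sym ?n" using p' by (simp add: row_stab_iff)
    have *: "(\<Sum>p\<in>?P. g (x \<circ> (p' \<circ> p))) = (\<Sum>p\<in>?P. g (x \<circ> p))" for x
      by (rule sum_Sym_left[symmetric, OF p'n]) (use row_stab_group(3)[OF p'] in \<open>auto simp: row_stab_iff\<close>)
    have mem: "\<tau> \<circ> p \<in> ?E \<longleftrightarrow> p \<in> ?E" if "p \<in> Sym ?n" for p
    proof -
      have tau_eq: "\<tau> y = \<gamma> x \<longleftrightarrow> y = \<gamma> x" if "x \<in> {1..s}" for x y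
      proof -
        have "\<gamma> x \<in> {1..s}" using permutes_in_image[of \<gamma> "{1..s}" x] assms(1) that by simp
        then have "\<tau> (\<gamma> x) = \<gamma> x" using tau by (simp add: extensions_def)
        then show ?thesis using inj_eq[of \<tau> y "\<gamma> x"] permutes_inj[of \<tau> "{1..?n}"] t by simp
      qed
      then show ?thesis using that Sym_compose[OF t that] by (simp add: extensions_def)
    qed
    have "(\<Sum>\<pi>\<in>?E. \<Sum>p\<in>?P. g (inv \<pi> \<circ> (\<tau> \<circ> \<Psi>) \<circ> p)) =
        (\<Sum>\<pi>\<in>?E. \<Sum>p\<in>?P. g (inv (\<tau> \<circ> \<pi>) \<circ> (\<tau> \<circ> \<Psi>) \<circ> p))"
      by (rule sum_Sym_left[OF t]) (simp_all add: mem, simp_all add: extensions_def)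
    also have "\<dots> = (\<Sum>\<pi>\<in>?E. \<Sum>p\<in>?P. g (inv \<pi> \<circ> \<Psi> \<circ> p))"
    proof (intro sum.cong refl arg_cong[where f = g])
      fix \<pi> p assume "\<pi> \<in> ?E"
      then have "\<pi> \<in> Sym ?n" by (simp add: extensions_def)
      then show "inv (\<tau> \<circ> \<pi>) \<circ> (\<tau> \<circ> \<Psi>) \<circ> p = inv \<pi> \<circ> \<Psi> \<circ> p"
        by (simp add: Sym_inv_compose[OF t] o_assoc[symmetric] Sym_cancel[OF t])
    qed
    finally have "(\<Sum>\<pi>\<in>?E. \<Sum>p\<in>?P. g (inv \<pi> \<circ> (\<tau> \<circ> \<Psi>) \<circ> p)) =
      (\<Sum>\<pi>\<in>?E. \<Sum>p\<in>?P. g (inv \<pi> \<circ> \<Psi> \<circ> p))" .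
    moreover have "(\<Sum>p\<in>?P. g (inv \<pi> \<circ> (\<tau> \<circ> \<Psi> \<circ> p') \<circ> p)) = (\<Sum>p\<in>?P. g (inv \<pi> \<circ> (\<tau> \<circ> \<Psi>) \<circ> p))" for \<pi>
      using *[of "inv \<pi> \<circ> (\<tau> \<circ> \<Psi>)"] by (simp only: o_assoc)
    ultimately show ?thesis by (simp only: h_def)
  qed
  \<comment> \<open>The value at a word is read off from an arbitrary filling with that word; the
    invariance of h makes the choice irrelevant. On words that do not occur the value is
    arbitrary.\<close>
  define u where "u = (\<lambda>w. h (SOME \<Psi>. \<Psi> \<in> Sym ?n \<and> row_word \<mu> s \<Psi> = w))"
  have u: "u (row_word \<mu> s \<Psi>) = h \<Psi>" if \<Psi>: "\<Psi> \<in> Sym ?n" for \<Psi>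
  proof -
    define \<Phi> where "\<Phi> = (SOME \<Phi>. \<Phi> \<in> Sym ?n \<and> row_word \<mu> s \<Phi> = row_word \<mu> s \<Psi>)"
    have "\<Phi> \<in> Sym ?n \<and> row_word \<mu> s \<Phi> = row_word \<mu> s \<Psi>"
      unfolding \<Phi>_def by (rule someI[of _ \<Psi>]) (use that in simp)
    then have \<Phi>: "\<Phi> \<in> Sym ?n" "row_word \<mu> s \<Phi> = row_word \<mu> s \<Psi>" by simp_all
    obtain \<tau> p where "\<tau> \<in> extensions ?n s id" "p \<in> ?P" "\<Psi> = \<tau> \<circ> \<Phi> \<circ> p"
      by (rule row_word_eqE[OF \<Phi>(1) \<Psi> assms(2) \<Phi>(2)])
    then have "h \<Psi> = h \<Phi>" using h_inv by simp
    then show ?thesis by (simp add: u_def \<Phi>_def)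
  qed
  have "ext_avg ?n s \<gamma> f x = col_antisym \<mu> s u x" for x
  proof (cases "x \<in> Sym ?n")
    case True
    have "f (inv \<pi> \<circ> x) = (\<Sum>q\<in>?Q. of_int (sign q) * (\<Sum>p\<in>?P. g (inv \<pi> \<circ> (x \<circ> q) \<circ> p)))"
      if "\<pi> \<in> ?E" for \<pi>
    proof -
      have "\<pi> \<in> Sym ?n" using that by (simp add: extensions_def)
      then have "inv \<pi> \<circ> x \<in> Sym ?n" using Sym_compose[OF Sym_inv True] by blast
      then show ?thesis unfolding f by (simp add: conv_young_symmetrizer o_assoc)
    qed
    then have "ext_avg ?n s \<gamma> f x =
        (\<Sum>\<pi>\<in>?E. \<Sum>q\<in>?Q. of_int (sign q) * (\<Sum>p\<in>?P. g (inv \<pi> \<circ> (x \<circ> q) \<circ> p))) / fact (?n - s)"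
      by (simp add: ext_avg_apply[OF True])
    also have "\<dots> = (\<Sum>q\<in>?Q. of_int (sign q) * h (x \<circ> q))"
      by (subst sum.swap) (simp add: h_def sum_distrib_left sum_divide_distrib)
    also have "\<dots> = (\<Sum>q\<in>?Q. of_int (sign q) * u (row_word \<mu> s (x \<circ> q)))"
    proof (intro sum.cong refl)
      fix q assume "q \<in> ?Q"
      then have "x \<circ> q \<in> Sym ?n" using Sym_compose[OF True, of q] by (simp add: col_stab_iff)
      then show "of_int (sign q) * h (x \<circ> q) = of_int (sign q) * u (row_word \<mu> s (x \<circ> q))"
        by (simp only: u)
    qed
    also have "\<dots> = col_antisym \<mu> s u x"
      using True by (simp add: col_antisym_def)
    finally show ?thesis .
  qed (simp add: ext_avg_outside, simp add: col_antisym_def)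
  then have "ext_avg ?n s \<gamma> f = col_antisym \<mu> s u" ..
  then show ?thesis by blast
qed

text \<open>\<open>ext_avg\<close> maps the whole Specht module into the range of
  \<open>col_antisym\<close>, which is itself part of the Specht module. Commuting
  \<open>ext_avg\<close> with the inclusion under the trace moves the trace to the smaller
  space.\<close>

lemma irr_char_extensions:
  assumes "\<gamma> \<in> Sym s" "s \<le> sum_list \<mu>"
  shows "(\<Sum>\<pi>\<in>extensions (sum_list \<mu>) s \<gamma>. irr_char \<mu> \<pi>) / fact (sum_list \<mu> - s)
    = cfun.trace_on (range (col_antisym \<mu> s)) (ext_avg (sum_list \<mu>) s \<gamma>)"
proof -
  let ?n = "sum_list \<mu>" and ?Y = "range (col_antisym \<mu> s)"
  interpret c: Vector_Spaces.linear "\<lambda>c (f :: (nat \<Rightarrow> nat) \<Rightarrow> complex) x. c * f x"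
    "\<lambda>c (f :: (nat \<Rightarrow> nat) \<Rightarrow> complex) x. c * f x" "col_antisym \<mu> s"
    by (rule clinear_col_antisym)
  have Y: "?Y \<subseteq> specht \<mu>" using col_antisym_in_specht by blast
  have fin: "cfun.subspace ?Y" "?Y \<subseteq> cfun.span (single ` Sym ?n)" "finite (single ` Sym ?n)"
    using c.subspace_image cfun.subspace_UNIV specht_finite_dim(2,3) Y by (blast+)
  have "(\<Sum>\<pi>\<in>extensions ?n s \<gamma>. irr_char \<mu> \<pi>) / fact (?n - s)
    = 1 / fact (?n - s) * (\<Sum>\<pi>\<in>extensions ?n s \<gamma>. cfun.trace_on (specht \<mu>) (conv ?n (single \<pi>)))"
    by (simp add: irr_char_def)
  also have "\<dots> = cfun.trace_on (specht \<mu>) (ext_avg ?n s \<gamma>)"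
    unfolding ext_avg_def
    by (rule cfun.trace_on_scale_sum[OF specht_finite_dim, symmetric])
       (auto simp: extensions_def intro: conv_single_specht)
  also have "\<dots> = cfun.trace_on ?Y (ext_avg ?n s \<gamma>)"
  proof (rule cfun.trace_on_commute[OF specht_finite_dim fin, where g = "\<lambda>x. x"])
    show "ext_avg ?n s \<gamma> ` specht \<mu> \<subseteq> ?Y" using ext_avg_specht[OF assms] by blast
    show "(\<lambda>x. x) ` ?Y \<subseteq> specht \<mu>" using Y by simp
  qed (rule clinear_ext_avg cfun.linear_ident)+
  finally show ?thesis .
qed

section \<open>Stability of the invariants in the number of boxes\<close>

lemma col_antisym_right:
  assumes "t \<in> col_stab \<mu>" "\<Phi> \<in> Sym (sum_list \<mu>)"
  shows "col_antisym \<mu> s u (\<Phi> \<circ> t) = of_int (sign t) * col_antisym \<mu> s u \<Phi>"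
proof -
  let ?n = "sum_list \<mu>" and ?Q = "col_stab \<mu>"
  have Q: "q \<in> Sym ?n" if "q \<in> ?Q" for q using that by (simp add: col_stab_iff)
  have "(\<Sum>q\<in>?Q. of_int (sign q) * u (row_word \<mu> s (\<Phi> \<circ> q)))
      = (\<Sum>q\<in>?Q. of_int (sign (t \<circ> q)) * u (row_word \<mu> s (\<Phi> \<circ> (t \<circ> q))))"
    by (rule sum_Sym_left[OF Q[OF assms(1)]]) (use col_stab_group(3)[OF assms(1)] Q in blast)+
  also have "\<dots> = of_int (sign t) * (\<Sum>q\<in>?Q. of_int (sign q) * u (row_word \<mu> s (\<Phi> \<circ> t \<circ> q)))"
    unfolding sum_distrib_left
    by (intro sum.cong refl) (simp add: sign_Sym_compose[OF Q[OF assms(1)] Q] o_assoc)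
  finally have "col_antisym \<mu> s u \<Phi> = of_int (sign t) * col_antisym \<mu> s u (\<Phi> \<circ> t)"
    using assms(2) Sym_compose[OF assms(2) Q[OF assms(1)]] by (simp add: col_antisym_def)
  moreover have "complex_of_int (sign t) * of_int (sign t) = 1"
    unfolding of_int_mult[symmetric] sign_idempotent by simp
  ultimately show ?thesis by (simp add: mult.assoc[symmetric])
qed

lemma extensions_id_inv:
  assumes "\<tau> \<in> extensions n s id"
  shows "inv \<tau> \<in> extensions n s id"
proof -
  have t: "\<tau> \<in> Sym n" "\<And>x. x \<in> {1..s} \<Longrightarrow> \<tau> x = x" using assms by (auto simp: extensions_def)
  have "inv \<tau> x = x" if "x \<in> {1..s}" for x
    using t(1) t(2)[OF that] permutes_inverses(2)[of \<tau> "{1..n}" x] by simp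
  then show ?thesis using Sym_inv[OF t(1)] by (simp add: extensions_def)
qed

lemma col_antisym_left:
  assumes "\<tau> \<in> extensions (sum_list \<mu>) s id" "\<Phi> \<in> Sym (sum_list \<mu>)"
  shows "col_antisym \<mu> s u (\<tau> \<circ> \<Phi>) = col_antisym \<mu> s u \<Phi>"
proof -
  have t: "\<tau> \<in> Sym (sum_list \<mu>)" using assms(1) by (simp add: extensions_def)
  have "row_word \<mu> s (\<tau> \<circ> \<Phi> \<circ> q) = row_word \<mu> s (\<Phi> \<circ> q)" if "q \<in> col_stab \<mu>" for q
  proof -
    have "\<Phi> \<circ> q \<in> Sym (sum_list \<mu>)" using Sym_compose[OF assms(2), of q] that by (simp add: col_stab_iff)
    then show ?thesis
      using row_word_left[OF _ extensions_id_inv[OF assms(1)], of "\<Phi> \<circ> q" \<mu>] Sym_inv_inv[OF t]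
      by (simp add: permutes_id o_assoc)
  qed
  then show ?thesis
    using Sym_compose[OF t assms(2)] assms(2) by (simp add: col_antisym_def)
qed

lemma transpose_extension:
  assumes "s < a" "a \<le> n" "s < b" "b \<le> n"
  shows "Transposition.transpose a b \<in> extensions n s id"
  using assms permutes_swap_id[of a "{1..n}" b] by (auto simp: extensions_def transpose_eq_iff)

lemma comp_transpose:
  assumes "\<Phi> \<in> Sym n"
  shows "\<Phi> \<circ> Transposition.transpose x y = Transposition.transpose (\<Phi> x) (\<Phi> y) \<circ> \<Phi>"
  using assms permutes_inj[of \<Phi>] by (auto simp: fun_eq_iff Transposition.transpose_def inj_eq)

text \<open>Swapping the boxes x and y is a column permutation and changes the sign, but it is also
  a swap of two blanks and changes nothing.\<close>

lemma col_antisym_eq_0: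
  assumes \<Phi>: "\<Phi> \<in> Sym (sum_list \<mu>)"
    and xy: "x \<in> {1..sum_list \<mu>}" "y \<in> {1..sum_list \<mu>}" "x \<noteq> y" "col_of \<mu> x = col_of \<mu> y"
    and s: "s < \<Phi> x" "s < \<Phi> y"
  shows "col_antisym \<mu> s u \<Phi> = 0"
proof -
  let ?t = "Transposition.transpose x y"
  have "\<Phi> x \<in> {1..sum_list \<mu>}" "\<Phi> y \<in> {1..sum_list \<mu>}"
    using \<Phi> xy permutes_in_image[of \<Phi> "{1..sum_list \<mu>}"] by simp_all
  then have ext: "Transposition.transpose (\<Phi> x) (\<Phi> y) \<in> extensions (sum_list \<mu>) s id"
    using s by (intro transpose_extension) auto
  have t: "?t \<in> col_stab \<mu>"
    using permutes_swap_id[OF xy(1,2)] xy(4) by (auto simp: col_stab_iff Transposition.transpose_def)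
  have "col_antisym \<mu> s u \<Phi> = col_antisym \<mu> s u (\<Phi> \<circ> ?t)"
    unfolding comp_transpose[OF \<Phi>] by (rule col_antisym_left[OF ext \<Phi>, symmetric])
  also have "\<dots> = - col_antisym \<mu> s u \<Phi>"
    using xy(3) by (simp add: col_antisym_right[OF t \<Phi>] sign_swap_id)
  finally show ?thesis by simp
qed

lemma card_blanks:
  assumes "\<Phi> \<in> Sym n" "s \<le> n"
  shows "card {x \<in> {1..n}. s < \<Phi> x} = n - s"
proof -
  have "bij_betw \<Phi> {x \<in> {1..n}. s < \<Phi> x} {s+1..n}"
    unfolding bij_betw_def
  proof
    show "inj_on \<Phi> {x \<in> {1..n}. s < \<Phi> x}" using assms(1) permutes_inj_on by auto
    have im: "\<Phi> ` {1..n} = {1..n}" using assms(1) permutes_image by auto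
    show "\<Phi> ` {x \<in> {1..n}. s < \<Phi> x} = {s+1..n}"
    proof
      show "\<Phi> ` {x \<in> {1..n}. s < \<Phi> x} \<subseteq> {s+1..n}" using im by fastforce
      show "{s+1..n} \<subseteq> \<Phi> ` {x \<in> {1..n}. s < \<Phi> x}"
      proof
        fix y assume y: "y \<in> {s+1..n}"
        then have "y \<in> \<Phi> ` {1..n}" unfolding im by simp
        then show "y \<in> \<Phi> ` {x \<in> {1..n}. s < \<Phi> x}" using y by auto
      qed
    qed
  qed
  then show ?thesis by (simp add: bij_betw_same_card)
qed

text \<open>By minimality of \<open>row_of\<close>, y lies beyond all earlier rows and within its
  own. So columns are numbered from 1, whereas rows are numbered from 0, and the column is bounded
  by the length of the row.\<close>

lemma col_of_bounds:
  assumes "y \<in> {1..sum_list lam}" "\<And>z. z \<in> set lam \<Longrightarrow> z \<le> m"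
  shows "col_of lam y \<in> {1..m}"
proof -
  define P where "P = (\<lambda>i. y \<le> sum_list (take (Suc i) lam))"
  define r where "r = row_of lam y"
  have r: "r = (LEAST i. P i)" by (simp add: r_def row_of_def P_def)
  have "P (length lam)" using assms(1) by (simp add: P_def)
  then have Pr: "P r" unfolding r by (rule LeastI)
  have lo: "sum_list (take r lam) < y"
  proof (cases r)
    case (Suc r')
    then have "\<not> P r'" using not_less_Least[of r' P] r by simp
    then show ?thesis by (simp add: P_def Suc)
  qed (use assms in simp)
  have rl: "r < length lam"
  proof (rule ccontr)
    assume "\<not> r < length lam"
    then show False using lo assms(1) by simp
  qed
  then have "y \<le> sum_list (take r lam) + lam ! r" using Pr by (simp add: P_def take_Suc_conv_app_nth)
  then show ?thesis
    using lo assms(2)[OF nth_mem[OF rl]] unfolding col_of_def r_def[symmetric] by auto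
qed

lemma col_of_pos:
  assumes "y \<in> {1..sum_list lam}"
  shows "1 \<le> col_of lam y"
  using col_of_bounds[OF assms, of "sum_list lam"] member_le_sum_list[of _ lam] by simp

lemma row_of_first:
  assumes "x \<le> N"
  shows "row_of (N # lam) x = 0" "col_of (N # lam) x = x"
proof -
  show "row_of (N # lam) x = 0"
    unfolding row_of_def using assms by (intro Least_equality) auto
  then show "col_of (N # lam) x = x" by (simp add: col_of_def)
qed

lemma row_of_rest:
  assumes "y \<in> {1..sum_list lam}"
  shows "row_of (N # lam) (N + y) = Suc (row_of lam y)" "col_of (N # lam) (N + y) = col_of lam y"
proof -
  have "(LEAST i. N + y \<le> sum_list (take (Suc i) (N # lam)))
      = Suc (LEAST i. N + y \<le> sum_list (take (Suc (Suc i)) (N # lam)))"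
    by (rule Least_Suc[where n = "Suc (length lam)"]) (use assms in auto)
  then show "row_of (N # lam) (N + y) = Suc (row_of lam y)"
    unfolding row_of_def by simp
  then show "col_of (N # lam) (N + y) = col_of lam y" by (simp add: col_of_def)
qed

text \<open>Rows below the first have length at most m, so a column beyond m consists of a single
  box of the first row, where the entry and the column number coincide.\<close>

lemma col_of_first_iff:
  assumes "x \<in> {1..N + sum_list lam}" "\<And>z. z \<in> set lam \<Longrightarrow> z \<le> m" "m < col_of (N # lam) x"
  shows "x \<le> N" "col_of (N # lam) x = x"
proof -
  show "x \<le> N"
  proof (rule ccontr)
    assume "\<not> x \<le> N"
    then have y: "x - N \<in> {1..sum_list lam}" and x: "x = N + (x - N)" using assms(1) by auto
    then have "col_of (N # lam) x \<in> {1..m}"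
      using row_of_rest(2)[OF y, of N] col_of_bounds[OF y assms(2)] by simp
    then show False using assms(3) by simp
  qed
  then show "col_of (N # lam) x = x" by (rule row_of_first)
qed

section \<open>Comparison of the shapes lam[n] and lam[n+1], where m bounds the parts of lam\<close>

context
  fixes lam :: "nat list" and m n s :: nat
  assumes parts: "\<And>z. z \<in> set lam \<Longrightarrow> z \<le> m"
    and n: "sum_list lam \<le> n" "m \<le> n - sum_list lam"
begin

lemma sum_list_pad: "sum_list (pad_partition n lam) = n"
  using n by (simp add: pad_partition_def)

lemma pad_Suc: "pad_partition (Suc n) lam = Suc (n - sum_list lam) # lam"
  using n by (simp add: pad_partition_def Suc_diff_le)

lemma sum_list_pad_Suc: "sum_list (pad_partition (Suc n) lam) = Suc n"
  using n by (simp add: pad_Suc)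

lemma col_of_pad_bounds:
  assumes "x \<in> {1..n}"
  shows "col_of (pad_partition n lam) x \<in> {1..n - sum_list lam}"
proof (cases "x \<le> n - sum_list lam")
  case True
  then show ?thesis using assms by (simp add: pad_partition_def row_of_first)
next
  case False
  then have y: "x - (n - sum_list lam) \<in> {1..sum_list lam}" and x: "x = n - sum_list lam + (x - (n - sum_list lam))"
    using assms n by auto
  have "col_of (pad_partition n lam) x = col_of lam (x - (n - sum_list lam))"
    using row_of_rest(2)[OF y, of "n - sum_list lam"] x by (simp add: pad_partition_def)
  moreover have "col_of lam (x - (n - sum_list lam)) \<in> {1..m}"
    by (rule col_of_bounds[OF y parts])
  ultimately show ?thesis using n by auto
qed

text \<open>An element of \<open>{s+1..n}\<close> is a blank of a filling. If \<open>s < |lam|\<close>, there are more blanks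
  than columns.\<close>

lemma col_antisym_pad_eq_0:
  assumes "s < sum_list lam"
  shows "col_antisym (pad_partition n lam) s u = (\<lambda>_. 0)"
proof
  let ?\<mu> = "pad_partition n lam"
  fix \<Phi>
  show "col_antisym ?\<mu> s u \<Phi> = 0"
  proof (cases "\<Phi> \<in> Sym n")
    case True
    define B where "B = {x \<in> {1..n}. s < \<Phi> x}"
    have "card (col_of ?\<mu> ` B) \<le> card {1..n - sum_list lam}"
      using col_of_pad_bounds by (intro card_mono) (auto simp: B_def)
    also have "\<dots> < card B"
      using card_blanks[OF True, of s] assms n by (simp add: B_def)
    finally have "\<not> inj_on (col_of ?\<mu>) B" using card_image by fastforce
    then obtain x y where "x \<in> B" "y \<in> B" "x \<noteq> y" "col_of ?\<mu> x = col_of ?\<mu> y"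
      unfolding inj_on_def by blast
    then show ?thesis
      using True by (intro col_antisym_eq_0[of \<Phi> ?\<mu> x y]) (auto simp: sum_list_pad B_def)
  qed (simp add: col_antisym_def sum_list_pad)
qed

text \<open>The inclusion of the boxes of \<open>lam[n]\<close> into those of \<open>lam[n+1]\<close>: the new box, at the end
  of the first row, corresponds to \<open>n+1\<close>.\<close>

definition box_incl :: "nat \<Rightarrow> nat" where
  "box_incl x = (if x \<le> n - sum_list lam \<or> Suc n < x then x
     else if x = Suc n then Suc (n - sum_list lam) else Suc x)"

lemma box_incl_Sym: "box_incl \<in> Sym (Suc n)"
proof -
  have "box_incl permutes {1..Suc n}"
  proof (rule inj_imp_permutes)
    show "inj_on box_incl {1..Suc n}"
      using n by (auto simp: inj_on_def box_incl_def split: if_splits)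
  qed (auto simp: box_incl_def)
  then show ?thesis by simp
qed

lemma row_col_box_incl:
  assumes "x \<in> {1..n}"
  shows "row_of (pad_partition (Suc n) lam) (box_incl x) = row_of (pad_partition n lam) x"
    "col_of (pad_partition (Suc n) lam) (box_incl x) = col_of (pad_partition n lam) x"
proof -
  have "row_of (pad_partition (Suc n) lam) (box_incl x) = row_of (pad_partition n lam) x \<and>
    col_of (pad_partition (Suc n) lam) (box_incl x) = col_of (pad_partition n lam) x"
  proof (cases "x \<le> n - sum_list lam")
    case True
    then show ?thesis unfolding pad_Suc unfolding pad_partition_def by (simp add: row_of_first box_incl_def)
  next
    case False
    define y where "y = x - (n - sum_list lam)"
    have y: "y \<in> {1..sum_list lam}" and x: "x = n - sum_list lam + y"
      using False assms n by (auto simp: y_def)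
    have "box_incl x = Suc (n - sum_list lam) + y"
      using False assms x by (simp add: box_incl_def)
    then show ?thesis
      using row_of_rest[OF y, of "n - sum_list lam"] row_of_rest[OF y, of "Suc (n - sum_list lam)"] x
      unfolding pad_Suc unfolding pad_partition_def by simp
  qed
  then show "row_of (pad_partition (Suc n) lam) (box_incl x) = row_of (pad_partition n lam) x"
    "col_of (pad_partition (Suc n) lam) (box_incl x) = col_of (pad_partition n lam) x" by auto
qed

lemma box_incl_new: "box_incl (Suc n) = Suc (n - sum_list lam)"
  by (auto simp: box_incl_def)

lemma col_of_pad_Suc_singleton:
  assumes "a \<in> {1..Suc n}" "b \<in> {1..Suc n}" "m < col_of (pad_partition (Suc n) lam) a"
    "col_of (pad_partition (Suc n) lam) a = col_of (pad_partition (Suc n) lam) b"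
  shows "a = b"
proof -
  let ?N = "Suc (n - sum_list lam)"
  have col: "col_of (pad_partition (Suc n) lam) x = x"
    if "x \<in> {1..Suc n}" "m < col_of (pad_partition (Suc n) lam) x" for x
  proof -
    have "x \<in> {1..?N + sum_list lam}" using that(1) n by simp
    from col_of_first_iff(2)[OF this parts] show ?thesis using that(2) unfolding pad_Suc by blast
  qed
  show ?thesis using col[OF assms(1,3)] col[OF assms(2)] assms(3,4) by simp
qed

lemma col_stab_fixes_singleton:
  assumes "q \<in> col_stab (pad_partition (Suc n) lam)" "a \<in> {1..Suc n}"
    "m < col_of (pad_partition (Suc n) lam) a"
  shows "q a = a"
proof -
  have q: "q \<in> Sym (Suc n)" and col: "\<And>x. col_of (pad_partition (Suc n) lam) (q x) = col_of (pad_partition (Suc n) lam) x"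
    using assms(1) by (auto simp: col_stab_iff sum_list_pad_Suc)
  have "q a \<in> {1..Suc n}" using q assms(2) permutes_in_image[of q "{1..Suc n}" a] by simp
  then show ?thesis
    using assms(3) by (intro col_of_pad_Suc_singleton[OF _ assms(2)]) (simp_all add: col)
qed

lemma col_of_new: "col_of (pad_partition (Suc n) lam) (Suc (n - sum_list lam)) = Suc (n - sum_list lam)"
  by (simp add: pad_Suc row_of_first)

text \<open>The new box has number at least m + 1 in the first row, hence is alone in its column and
  fixed by every column permutation of the larger shape. Conjugation by \<open>box_incl\<close>
  therefore identifies the two column stabilizers.\<close>

lemma col_stab_conj_box_incl:
  "q \<in> col_stab (pad_partition n lam) \<Longrightarrow>
     box_incl \<circ> q \<circ> inv box_incl \<in> col_stab (pad_partition (Suc n) lam)"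
  "q \<in> col_stab (pad_partition (Suc n) lam) \<Longrightarrow>
     inv box_incl \<circ> q \<circ> box_incl \<in> col_stab (pad_partition n lam)"
proof -
  let ?\<mu> = "pad_partition n lam" and ?\<mu>' = "pad_partition (Suc n) lam" and ?b = box_incl
  note b = box_incl_Sym
  have inv_b: "inv ?b (?b x) = x" "?b (inv ?b x) = x" for x
    using b by (simp_all add: permutes_inverses)
  have b_in: "?b x \<in> {1..Suc n} \<longleftrightarrow> x \<in> {1..Suc n}" for x
    using b permutes_in_image[of ?b "{1..Suc n}" x] by simp
  show "?b \<circ> q \<circ> inv ?b \<in> col_stab ?\<mu>'" if "q \<in> col_stab ?\<mu>"
  proof -
    have q: "q \<in> Sym n" "\<And>x. col_of ?\<mu> (q x) = col_of ?\<mu> x"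
      using that by (auto simp: col_stab_iff sum_list_pad)
    have "q \<in> Sym (Suc n)" using Sym_mono[of n "Suc n" q] q by simp
    then have mem: "?b \<circ> q \<circ> inv ?b \<in> Sym (Suc n)" by (rule Sym_compose[OF Sym_compose[OF b] Sym_inv[OF b]])
    have conj: "col_of ?\<mu>' ((?b \<circ> q \<circ> inv ?b) (?b x)) = col_of ?\<mu>' (?b x)" if "x \<in> {1..Suc n}" for x
    proof (cases "x = Suc n")
      case True
      have "q (Suc n) = Suc n" using q(1) permutes_not_in[of q "{1..n}" "Suc n"] by simp
      then show ?thesis by (simp add: inv_b True)
    next
      case False
      then have x: "x \<in> {1..n}" using that by simp
      moreover then have "q x \<in> {1..n}" using q(1) permutes_in_image[of q "{1..n}" x] by simp
      ultimately show ?thesis using q(2) by (simp add: inv_b row_col_box_incl)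
    qed
    have "col_of ?\<mu>' ((?b \<circ> q \<circ> inv ?b) x) = col_of ?\<mu>' x" if "x \<in> {1..Suc n}" for x
    proof -
      have "inv ?b x \<in> {1..Suc n}" using b_in[of "inv ?b x"] that unfolding inv_b by blast
      from conj[OF this] show ?thesis unfolding inv_b .
    qed
    then show ?thesis using mem by (simp add: col_stab_def sum_list_pad_Suc)
  qed
  show "inv ?b \<circ> q \<circ> ?b \<in> col_stab ?\<mu>" if q: "q \<in> col_stab ?\<mu>'"
  proof -
    have qn: "q \<in> Sym (Suc n)" and col: "\<And>x. col_of ?\<mu>' (q x) = col_of ?\<mu>' x"
      using q by (auto simp: col_stab_iff sum_list_pad_Suc)
    have mem: "inv ?b \<circ> q \<circ> ?b \<in> Sym (Suc n)" by (rule Sym_compose[OF Sym_compose[OF Sym_inv[OF b] qn] b])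
    have "q (Suc (n - sum_list lam)) = Suc (n - sum_list lam)"
      by (rule col_stab_fixes_singleton[OF q]) (use n in \<open>simp_all add: col_of_new\<close>)
    then have "(inv ?b \<circ> q \<circ> ?b) (Suc n) = Suc n" by (simp add: box_incl_new[symmetric] inv_b)
    then have Sn: "inv ?b \<circ> q \<circ> ?b permutes {1..n}"
      by (intro permutes_superset[OF mem[unfolded mem_Collect_eq]]) (auto simp: atLeastAtMostSuc_conv)
    have "col_of ?\<mu> ((inv ?b \<circ> q \<circ> ?b) x) = col_of ?\<mu> x" if x: "x \<in> {1..n}" for x
    proof -
      have "(inv ?b \<circ> q \<circ> ?b) x \<in> {1..n}" using permutes_in_image[OF Sn, of x] x by simp
      from row_col_box_incl(2)[OF this] row_col_box_incl(2)[OF x] show ?thesis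
        using col by (simp add: inv_b)
    qed
    then show ?thesis using Sn by (simp add: col_stab_def sum_list_pad)
  qed
qed

text \<open>\<open>\<Phi> \<circ> inv box_incl\<close> is the filling \<Phi> of lam[n] with the
  label n+1 added in the new box. As s is at most n, this label is a blank and does not enter the
  word; conjugation by \<open>box_incl\<close> matches the column permutations together with their
  signs.\<close>

lemma col_antisym_box_incl:
  assumes "s \<le> n" "\<Phi> \<in> Sym n"
  shows "col_antisym (pad_partition (Suc n) lam) s u (\<Phi> \<circ> inv box_incl)
    = col_antisym (pad_partition n lam) s u \<Phi>"
proof -
  let ?\<mu> = "pad_partition n lam" and ?\<mu>' = "pad_partition (Suc n) lam" and ?b = box_incl
  note b = box_incl_Sym
  have Q: "q \<in> Sym n" "q \<in> Sym (Suc n)" if "q \<in> col_stab ?\<mu>" for q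
    using that Sym_mono[of n "Suc n" q] by (auto simp: col_stab_iff sum_list_pad)
  have \<Phi>: "\<Phi> \<in> Sym (Suc n)" using assms Sym_mono[of n "Suc n"] by simp
  have word: "row_word ?\<mu>' s (\<Psi> \<circ> inv ?b) = row_word ?\<mu> s \<Psi>" if \<Psi>: "\<Psi> \<in> Sym n" for \<Psi>
  proof
    fix x
    have "inv (\<Psi> \<circ> inv ?b) = ?b \<circ> inv \<Psi>"
      using Sym_inv_compose[OF Sym_mono[OF _ \<Psi>] Sym_inv[OF b]] Sym_inv_inv[OF b] by simp
    moreover have "inv \<Psi> x \<in> {1..n}" if "x \<in> {1..s}"
      using Sym_inv[OF \<Psi>] permutes_in_image[of "inv \<Psi>" "{1..n}" x] that assms(1) by simp
    ultimately show "row_word ?\<mu>' s (\<Psi> \<circ> inv ?b) x = row_word ?\<mu> s \<Psi> x"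
      using row_col_box_incl(1) by (simp add: row_word_def)
  qed
  have "(\<Sum>q\<in>col_stab ?\<mu>'. of_int (sign q) * u (row_word ?\<mu>' s (\<Phi> \<circ> inv ?b \<circ> q)))
      = (\<Sum>q\<in>col_stab ?\<mu>. of_int (sign q) * u (row_word ?\<mu> s (\<Phi> \<circ> q)))"
  proof (rule sum.reindex_bij_witness[of _ "\<lambda>q. ?b \<circ> q \<circ> inv ?b" "\<lambda>q. inv ?b \<circ> q \<circ> ?b"])
    fix q assume q: "q \<in> col_stab ?\<mu>'"
    define r where "r = inv ?b \<circ> q \<circ> ?b"
    have r: "r \<in> col_stab ?\<mu>" unfolding r_def by (rule col_stab_conj_box_incl(2)[OF q])
    have qr: "q = ?b \<circ> r \<circ> inv ?b"
      by (simp add: r_def o_assoc[symmetric] Sym_cancel[OF b] Sym_inv_o[OF b])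
    have "sign q = sign r"
      unfolding qr using sign_Sym_compose[OF Sym_compose[OF b Q(2)[OF r]] Sym_inv[OF b]]
        sign_Sym_compose[OF b Q(2)[OF r]] sign_Sym_inv[OF b] by (simp add: mult.commute)
    moreover have "\<Phi> \<circ> inv ?b \<circ> q = (\<Phi> \<circ> r) \<circ> inv ?b"
      by (simp add: qr o_assoc[symmetric] Sym_cancel[OF b])
    moreover have "\<Phi> \<circ> r \<in> Sym n" using Sym_compose[OF assms(2) Q(1)[OF r]] .
    ultimately show "of_int (sign (inv ?b \<circ> q \<circ> ?b)) * u (row_word ?\<mu> s (\<Phi> \<circ> (inv ?b \<circ> q \<circ> ?b)))
        = of_int (sign q) * u (row_word ?\<mu>' s (\<Phi> \<circ> inv ?b \<circ> q))"
      by (simp add: r_def[symmetric] word)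
  next
    show "inv ?b \<circ> (?b \<circ> q \<circ> inv ?b) \<circ> ?b = q" for q
      by (simp add: o_assoc[symmetric] Sym_cancel[OF b] Sym_inv_o[OF b])
    show "?b \<circ> (inv ?b \<circ> q \<circ> ?b) \<circ> inv ?b = q" for q
      by (simp add: o_assoc[symmetric] Sym_cancel[OF b] Sym_inv_o[OF b])
  qed (use col_stab_conj_box_incl in blast)+
  moreover have "\<Phi> \<circ> inv ?b \<in> Sym (Suc n)" by (rule Sym_compose[OF \<Phi> Sym_inv[OF b]])
  ultimately show ?thesis
    using assms(2) by (simp add: col_antisym_def sum_list_pad sum_list_pad_Suc)
qed

text \<open>Two blanks in one column make \<open>col_antisym\<close> vanish. Otherwise one of the blanks is in a
  single-box column, since there are more than \<open>m\<close> of them, and it can be moved to the new box.\<close>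

lemma col_antisym_ker_Suc:
  assumes s: "s + sum_list lam \<le> n" "m \<le> sum_list lam"
  shows "col_antisym (pad_partition n lam) s u = 0 \<longleftrightarrow> col_antisym (pad_partition (Suc n) lam) s u = 0"
proof
  let ?\<mu> = "pad_partition n lam" and ?\<mu>' = "pad_partition (Suc n) lam" and ?b = box_incl
  have sn: "s \<le> n" using s by simp
  assume "col_antisym ?\<mu>' s u = 0"
  then have "col_antisym ?\<mu> s u \<Phi> = 0" for \<Phi>
    using col_antisym_box_incl[OF sn, of \<Phi> u] by (cases "\<Phi> \<in> Sym n") (simp_all add: col_antisym_def sum_list_pad)
  then show "col_antisym ?\<mu> s u = 0" by (simp add: fun_eq_iff)
next
  let ?\<mu> = "pad_partition n lam" and ?\<mu>' = "pad_partition (Suc n) lam" and ?b = box_incl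
  let ?N = "Suc (n - sum_list lam)"
  note b = box_incl_Sym
  have sn: "s \<le> n" using s by simp
  have N: "?N \<in> {1..Suc n}" "m < col_of ?\<mu>' ?N" using n by (simp_all add: col_of_new)
  assume zero: "col_antisym ?\<mu> s u = 0"
  have "col_antisym ?\<mu>' s u \<Phi> = 0" if \<Phi>: "\<Phi> \<in> Sym (Suc n)" for \<Phi>
  proof (cases "inj_on (col_of ?\<mu>') {x \<in> {1..Suc n}. s < \<Phi> x}")
    case False
    then obtain x y where "x \<in> {1..Suc n}" "y \<in> {1..Suc n}" "s < \<Phi> x" "s < \<Phi> y" "x \<noteq> y"
        "col_of ?\<mu>' x = col_of ?\<mu>' y"
      unfolding inj_on_def by blast
    then show ?thesis
      using \<Phi> by (intro col_antisym_eq_0[of \<Phi> ?\<mu>' x y]) (simp_all add: sum_list_pad_Suc)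
  next
    case True
    let ?B = "{x \<in> {1..Suc n}. s < \<Phi> x}"
    \<comment> \<open>There are n + 1 - s blanks, more than |lam| and so more than m. They lie in
      distinct columns, hence one of them lies beyond column m.\<close>
    have "\<not> col_of ?\<mu>' ` ?B \<subseteq> {..m}"
    proof
      assume "col_of ?\<mu>' ` ?B \<subseteq> {..m}"
      then have sub: "col_of ?\<mu>' ` ?B \<subseteq> {1..m}"
      proof -
        have "1 \<le> col_of ?\<mu>' x" if "x \<in> {1..Suc n}" for x
          using col_of_pos[of x "pad_partition (Suc n) lam"] that by (simp add: sum_list_pad_Suc)
        then show ?thesis using \<open>col_of ?\<mu>' ` ?B \<subseteq> {..m}\<close> by fastforce
      qed
      have "card ?B = card (col_of ?\<mu>' ` ?B)" using card_image[OF True] by simp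
      also have "\<dots> \<le> m" using card_mono[OF _ sub] by simp
      finally show False using card_blanks[OF \<Phi>, of s] s by simp
    qed
    then obtain z where z: "z \<in> {1..Suc n}" "s < \<Phi> z" "m < col_of ?\<mu>' z"
      unfolding image_subset_iff atMost_iff not_le[symmetric] by blast
    let ?r = "Transposition.transpose z ?N"
    define \<Psi> where "\<Psi> = \<Phi> \<circ> ?r"
    have r: "?r \<in> Sym (Suc n)" using permutes_swap_id[OF z(1) N(1)] by simp
    have row0: "row_of ?\<mu>' z = 0" "row_of ?\<mu>' ?N = 0"
    proof -
      have "z \<in> {1..?N + sum_list lam}" using z(1) n by simp
      then have "z \<le> ?N" using col_of_first_iff(1)[OF _ parts] z(3) unfolding pad_Suc by blast
      then show "row_of ?\<mu>' z = 0" "row_of ?\<mu>' ?N = 0" unfolding pad_Suc by (simp_all add: row_of_first)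
    qed
    have r_row: "?r \<in> row_stab ?\<mu>'"
      using r row0 unfolding row_stab_iff sum_list_pad_Suc by (auto simp: Transposition.transpose_def)
    have \<Psi>: "\<Psi> \<in> Sym (Suc n)" unfolding \<Psi>_def by (rule Sym_compose[OF \<Phi> r])
    have "col_antisym ?\<mu>' s u \<Psi> = col_antisym ?\<mu>' s u \<Phi>"
    proof -
      have "row_word ?\<mu>' s (\<Psi> \<circ> q) = row_word ?\<mu>' s (\<Phi> \<circ> q)" if q: "q \<in> col_stab ?\<mu>'" for q
      proof -
        have qn: "q \<in> Sym (Suc n)" using q by (simp add: col_stab_iff sum_list_pad_Suc)
        \<comment> \<open>Both boxes are alone in their columns and thus fixed by q. So the swap
          commutes with q, moves to the right end and is absorbed there as a row
          permutation.\<close>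
        have "q z = z" "q ?N = ?N"
          using col_stab_fixes_singleton[OF q z(1,3)] col_stab_fixes_singleton[OF q N] by simp_all
        then have "?r \<circ> q = q \<circ> ?r" using comp_transpose[OF qn, of z ?N] by simp
        then have "\<Psi> \<circ> q = \<Phi> \<circ> q \<circ> ?r" by (simp add: \<Psi>_def o_assoc[symmetric])
        then show ?thesis
          using row_word_right[OF r_row] Sym_compose[OF \<Phi> qn] by (simp add: sum_list_pad_Suc)
      qed
      then show ?thesis using \<Phi> \<Psi> by (simp add: col_antisym_def sum_list_pad_Suc)
    qed
    \<comment> \<open>In \<Psi> the new box holds the blank \<Phi> z. Exchanging it with the blank
      n+1 costs nothing and puts n+1 into the new box, where \<open>col_antisym_box_incl\<close>
      applies.\<close>
    moreover define \<tau> where "\<tau> = Transposition.transpose (\<Phi> z) (Suc n)"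
    have "\<Phi> z \<in> {1..Suc n}" using permutes_in_image[of \<Phi> "{1..Suc n}" z] \<Phi> z(1) by simp
    then have \<tau>: "\<tau> \<in> extensions (Suc n) s id"
      unfolding \<tau>_def using z(2) sn by (intro transpose_extension) auto
    then have "col_antisym ?\<mu>' s u (\<tau> \<circ> \<Psi>) = col_antisym ?\<mu>' s u \<Psi>"
      using \<Psi> by (intro col_antisym_left) (simp_all add: sum_list_pad_Suc)
    moreover have "col_antisym ?\<mu>' s u (\<tau> \<circ> \<Psi>) = 0"
    proof -
      define \<Phi>' where "\<Phi>' = \<tau> \<circ> \<Psi> \<circ> ?b"
      have \<tau>n: "\<tau> \<in> Sym (Suc n)" using \<tau> by (simp add: extensions_def)
      have \<Phi>'n: "\<Phi>' \<in> Sym (Suc n)"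
        unfolding \<Phi>'_def by (rule Sym_compose[OF Sym_compose[OF \<tau>n \<Psi>] b])
      have "\<Phi>' (Suc n) = Suc n"
        by (simp add: \<Phi>'_def box_incl_new \<Psi>_def \<tau>_def)
      then have "\<Phi>' permutes {1..n}"
        by (intro permutes_superset[OF \<Phi>'n[unfolded mem_Collect_eq]]) (auto simp: atLeastAtMostSuc_conv)
      then have "col_antisym ?\<mu>' s u (\<Phi>' \<circ> inv ?b) = 0"
        using col_antisym_box_incl[OF sn, of \<Phi>' u] zero by simp
      moreover have "\<Phi>' \<circ> inv ?b = \<tau> \<circ> \<Psi>" by (simp add: \<Phi>'_def Sym_cancel[OF b])
      ultimately show ?thesis by simp
    qed
    ultimately show ?thesis by simp
  qed
  then have "col_antisym ?\<mu>' s u \<Phi> = 0" for \<Phi>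
    by (cases "\<Phi> \<in> Sym (Suc n)") (simp_all add: col_antisym_def sum_list_pad_Suc)
  then show "col_antisym ?\<mu>' s u = 0" by (simp add: fun_eq_iff)
qed

end

section \<open>The trace on the invariants as a function of n\<close>

lemma trace_on_zero: "cfun.trace_on {\<lambda>_. 0} f = 0"
proof -
  have W: "cfun.subspace {\<lambda>_. 0}" "{\<lambda>_. 0} \<subseteq> cfun.span {}"
    by (auto simp: cfun.subspace_def plus_fun_def zero_fun_def)
  define B where "B = (SOME B. cfun.independent B \<and> cfun.span B = {\<lambda>_. 0})"
  note B = cfun.finite_dim_trace_basis[OF W finite.emptyI, folded B_def]
  have "B \<subseteq> {0}" using B(2) cfun.span_superset[of B] by (auto simp: zero_fun_def)
  moreover have "0 \<notin> B" using B(1) cfun.dependent_zero by blast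
  ultimately have "B = {}" by blast
  then show ?thesis by (simp add: cfun.trace_on_def B_def[symmetric] Let_def)
qed

text \<open>For \<gamma> in Sym s this is the trace of \<gamma> on the vectors of the Specht module
  of lam[n] that are invariant under the permutations of {s+1..n}.\<close>

definition ext_char_avg :: "nat list \<Rightarrow> nat \<Rightarrow> nat \<Rightarrow> (nat \<Rightarrow> nat) \<Rightarrow> complex" where
  "ext_char_avg lam n s \<gamma> = (\<Sum>\<pi>\<in>extensions n s \<gamma>. irr_char (pad_partition n lam) \<pi>) / fact (n - s)"

lemma range_col_antisym_finite_dim:
  "range (col_antisym \<mu> s) \<subseteq> cfun.span (single ` Sym (sum_list \<mu>))"
  using col_antisym_in_specht specht_finite_dim(2) by blast

text \<open>The two spaces of invariants are images of the same space of functions on words, under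
  maps with the same kernel that intertwine the action of \<gamma> with the same operator on that
  space. No map between the two Specht modules has to be constructed.\<close>

lemma ext_char_avg_Suc:
  assumes parts: "\<And>z. z \<in> set lam \<Longrightarrow> z \<le> m"
    and n: "sum_list lam \<le> n" "m \<le> n - sum_list lam"
    and s: "s + sum_list lam \<le> n" "m \<le> sum_list lam"
    and g: "\<gamma> \<in> Sym s"
  shows "ext_char_avg lam (Suc n) s \<gamma> = ext_char_avg lam n s \<gamma>"
proof -
  let ?\<mu> = "pad_partition n lam" and ?\<mu>' = "pad_partition (Suc n) lam"
  have len: "sum_list ?\<mu> = n" "sum_list ?\<mu>' = Suc n"
    using sum_list_pad[OF parts n] sum_list_pad_Suc[OF parts n] by simp_all
  have "ext_char_avg lam n s \<gamma> = cfun.trace_on (range (col_antisym ?\<mu> s)) (ext_avg n s \<gamma>)"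
    using irr_char_extensions[OF g, of ?\<mu>] s len by (simp add: ext_char_avg_def)
  also have "\<dots> = cfun.trace_on (range (col_antisym ?\<mu>' s)) (ext_avg (Suc n) s \<gamma>)"
  proof (rule cfun.trace_on_range_cong_ker[OF clinear_col_antisym clinear_col_antisym
        clinear_ext_avg clinear_ext_avg _ _ _ range_col_antisym_finite_dim _ range_col_antisym_finite_dim])
    show "col_antisym ?\<mu> s u = 0 \<longleftrightarrow> col_antisym ?\<mu>' s u = 0" for u
      by (rule col_antisym_ker_Suc[OF parts n s])
    show "ext_avg n s \<gamma> (col_antisym ?\<mu> s u) = col_antisym ?\<mu> s ((\<lambda>u w. u (w \<circ> \<gamma>)) u)" for u
      using ext_avg_col_antisym[OF g, of ?\<mu>] s len by simp
    show "ext_avg (Suc n) s \<gamma> (col_antisym ?\<mu>' s u) = col_antisym ?\<mu>' s ((\<lambda>u w. u (w \<circ> \<gamma>)) u)" for u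
      using ext_avg_col_antisym[OF g, of ?\<mu>'] s len by simp
  qed (intro finite_imageI finite_Sym)+
  also have "\<dots> = ext_char_avg lam (Suc n) s \<gamma>"
    using irr_char_extensions[OF g, of ?\<mu>'] s len by (simp add: ext_char_avg_def)
  finally show ?thesis ..
qed

lemma ext_char_avg_eq_0:
  assumes parts: "\<And>z. z \<in> set lam \<Longrightarrow> z \<le> m"
    and n: "sum_list lam \<le> n" "m \<le> n - sum_list lam"
    and s: "s < sum_list lam"
    and g: "\<gamma> \<in> Sym s"
  shows "ext_char_avg lam n s \<gamma> = 0"
proof -
  let ?\<mu> = "pad_partition n lam"
  have len: "sum_list ?\<mu> = n" by (rule sum_list_pad[OF parts n])
  have "range (col_antisym ?\<mu> s) = {\<lambda>_. 0}"
    using col_antisym_pad_eq_0[OF parts n s] by auto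
  then show ?thesis
    using irr_char_extensions[OF g, of ?\<mu>] s n len trace_on_zero by (simp add: ext_char_avg_def)
qed

section \<open>Embeddings into the graph of a permutation\<close>

text \<open>The vertex set is kept apart from the edges because the removal of a source can leave a
  vertex without edges.\<close>

definition embeddings :: "nat \<Rightarrow> 'a set \<Rightarrow> ('a \<times> 'a) set \<Rightarrow> (nat \<Rightarrow> nat) \<Rightarrow> ('a \<Rightarrow> nat) set" where
  "embeddings n V E \<pi> = {\<iota> \<in> V \<rightarrow>\<^sub>E {1..n}. inj_on \<iota> V \<and> (\<forall>(x, y)\<in>E. \<pi> (\<iota> x) = \<iota> y)}"

definition emb_avg :: "((nat \<Rightarrow> nat) \<Rightarrow> complex) \<Rightarrow> nat \<Rightarrow> 'a set \<Rightarrow> ('a \<times> 'a) set \<Rightarrow> complex" where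
  "emb_avg F n V E = (\<Sum>\<pi>\<in>Sym n. F \<pi> * of_nat (card (embeddings n V E \<pi>))) / fact n"

definition graph_sum :: "((nat \<Rightarrow> nat) \<Rightarrow> complex) \<Rightarrow> nat \<Rightarrow> ('a \<times> 'a) set \<Rightarrow> ('a \<Rightarrow> nat) \<Rightarrow> complex" where
  "graph_sum F n E \<iota> = sum F {\<pi> \<in> Sym n. \<forall>(x, y)\<in>E. \<pi> (\<iota> x) = \<iota> y}"

lemma finite_embeddings: "finite V \<Longrightarrow> finite (embeddings n V E \<pi>)"
  unfolding embeddings_def by (rule finite_subset[of _ "V \<rightarrow>\<^sub>E {1..n}"]) (auto intro: finite_PiE)

lemma ex_Sym_extending:
  assumes "finite V" "inj_on f V" "inj_on g V" "f ` V \<subseteq> {1..n}" "g ` V \<subseteq> {1..n}"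
  obtains \<tau> where "\<tau> \<in> Sym n" "\<And>x. x \<in> V \<Longrightarrow> \<tau> (f x) = g x"
proof -
  have "card ({1..n} - f ` V) = card ({1..n} - g ` V)"
    using assms by (simp add: card_Diff_subset card_image)
  then obtain h where h: "bij_betw h ({1..n} - f ` V) ({1..n} - g ` V)"
    using finite_same_card_bij[of "{1..n} - f ` V" "{1..n} - g ` V"] by blast
  define k where "k = (\<lambda>x. g (inv_into V f x))"
  have k: "bij_betw k (f ` V) (g ` V)"
    unfolding k_def using bij_betw_trans[OF bij_betw_inv_into[OF inj_on_imp_bij_betw[OF assms(2)]] inj_on_imp_bij_betw[OF assms(3)]]
    by (simp add: comp_def)
  define t where "t = (\<lambda>x. if x \<in> f ` V then k x else if x \<in> {1..n} then h x else x)"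
  have "bij_betw (\<lambda>x. if x \<in> f ` V then k x else h x) (f ` V \<union> ({1..n} - f ` V)) (g ` V \<union> ({1..n} - g ` V))"
    by (rule bij_betw_disjoint_Un[OF k h]) auto
  also have "f ` V \<union> ({1..n} - f ` V) = {1..n}" using assms(4) by auto
  also have "g ` V \<union> ({1..n} - g ` V) = {1..n}" using assms(5) by auto
  finally have "bij_betw t {1..n} {1..n}"
    by (rule iffD1[OF bij_betw_cong, rotated]) (auto simp: t_def)
  then have "t permutes {1..n}"
    by (rule bij_imp_permutes) (use assms(4) in \<open>auto simp: t_def\<close>)
  moreover have "t (f x) = g x" if "x \<in> V" for x
    using that inv_into_f_f[OF assms(2) that] by (simp add: t_def k_def)
  ultimately show thesis using that by blast
qed

text \<open>Conjugation by a permutation that carries the placement f to the placement g matches the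
  two sets of permutations, and F does not notice it.\<close>

lemma graph_sum_cong:
  assumes F: "\<And>\<tau> \<pi>. \<tau> \<in> Sym n \<Longrightarrow> \<pi> \<in> Sym n \<Longrightarrow> F (\<tau> \<circ> \<pi> \<circ> inv \<tau>) = F \<pi>"
    and "finite V" "Field E \<subseteq> V" "inj_on f V" "inj_on g V" "f ` V \<subseteq> {1..n}" "g ` V \<subseteq> {1..n}"
  shows "graph_sum F n E f = graph_sum F n E g"
proof -
  obtain t where t: "t \<in> Sym n" and tf: "\<And>x. x \<in> V \<Longrightarrow> t (f x) = g x"
    using ex_Sym_extending[OF assms(2,4-7)] by blast
  have inv_t: "inv t (t x) = x" "t (inv t x) = x" for x
    using t by (simp_all add: permutes_inverses)
  have tg: "inv t (g x) = f x" if "x \<in> V" for x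
    unfolding tf[OF that, symmetric] by (rule inv_t)
  have EV: "x \<in> V" "y \<in> V" if "(x, y) \<in> E" for x y
    using assms(3) that by (auto simp: Field_def)
  show ?thesis
    unfolding graph_sum_def
  proof (rule sum.reindex_bij_witness[of _ "\<lambda>\<pi>. inv t \<circ> \<pi> \<circ> t" "\<lambda>\<pi>. t \<circ> \<pi> \<circ> inv t"])
    fix \<pi> assume "\<pi> \<in> {\<pi> \<in> Sym n. \<forall>(x, y)\<in>E. \<pi> (f x) = f y}"
    then have p: "\<pi> \<in> Sym n" and pE: "\<And>x y. (x, y) \<in> E \<Longrightarrow> \<pi> (f x) = f y" by auto
    show "inv t \<circ> (t \<circ> \<pi> \<circ> inv t) \<circ> t = \<pi>" by (simp add: fun_eq_iff inv_t)
    have "t \<circ> \<pi> \<circ> inv t \<in> Sym n" by (rule Sym_compose[OF Sym_compose[OF t p] Sym_inv[OF t]])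
    moreover have "(t \<circ> \<pi> \<circ> inv t) (g x) = g y" if "(x, y) \<in> E" for x y
      using EV[OF that] pE[OF that] by (simp add: tg tf)
    ultimately show "t \<circ> \<pi> \<circ> inv t \<in> {\<pi> \<in> Sym n. \<forall>(x, y)\<in>E. \<pi> (g x) = g y}" by auto
    show "F (t \<circ> \<pi> \<circ> inv t) = F \<pi>" by (rule F[OF t p])
  next
    fix \<pi> assume "\<pi> \<in> {\<pi> \<in> Sym n. \<forall>(x, y)\<in>E. \<pi> (g x) = g y}"
    then have p: "\<pi> \<in> Sym n" and pE: "\<And>x y. (x, y) \<in> E \<Longrightarrow> \<pi> (g x) = g y" by auto
    show "t \<circ> (inv t \<circ> \<pi> \<circ> t) \<circ> inv t = \<pi>" by (simp add: fun_eq_iff inv_t)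
    have "inv t \<circ> \<pi> \<circ> t \<in> Sym n" by (rule Sym_compose[OF Sym_compose[OF Sym_inv[OF t] p] t])
    moreover have "(inv t \<circ> \<pi> \<circ> t) (f x) = f y" if "(x, y) \<in> E" for x y
      using EV[OF that] pE[OF that] by (simp add: tg tf)
    ultimately show "inv t \<circ> \<pi> \<circ> t \<in> {\<pi> \<in> Sym n. \<forall>(x, y)\<in>E. \<pi> (f x) = f y}" by auto
  qed
qed

lemma card_injections:
  assumes "finite V" "card V \<le> n"
  shows "of_nat (card {\<iota> \<in> V \<rightarrow>\<^sub>E {1..n}. inj_on \<iota> V}) = (fact n / fact (n - card V) :: complex)"
proof -
  have "of_nat (prod ((-) n) {0..<k}) * fact (n - k) = (fact n :: complex)" if "k \<le> n" for k
    using that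
  proof (induction k)
    case (Suc k)
    have "n - k = Suc (n - Suc k)" using Suc.prems by simp
    then have "(fact (n - k) :: complex) = of_nat (n - k) * fact (n - Suc k)"
      using fact_Suc[of "n - Suc k", where 'a = complex] by simp
    then show ?case using Suc by (simp add: mult.assoc)
  qed simp
  from this[OF assms(2)] show ?thesis
    using card_inj_on_subset_funcset[OF assms(1) finite_atLeastAtMost order_refl, of 1 n]
    by (simp add: field_simps)
qed

text \<open>After exchanging the sums, every one of the n!/(n - |V|)! placements contributes the
  same amount, and n! cancels.\<close>

lemma emb_avg_graph_sum:
  assumes F: "\<And>\<tau> \<pi>. \<tau> \<in> Sym n \<Longrightarrow> \<pi> \<in> Sym n \<Longrightarrow> F (\<tau> \<circ> \<pi> \<circ> inv \<tau>) = F \<pi>"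
    and V: "finite V" "Field E \<subseteq> V" "inj_on f V" "f ` V \<subseteq> {1..n}"
  shows "emb_avg F n V E = graph_sum F n E f / fact (n - card V)"
proof -
  let ?I = "{\<iota> \<in> V \<rightarrow>\<^sub>E {1..n}. inj_on \<iota> V}"
  have fin: "finite ?I"
    using V(1) by (auto intro: finite_subset[OF _ finite_PiE[OF V(1), of "\<lambda>_. {1..n}"]])
  have card: "card V \<le> n" using card_inj_on_le[OF V(3,4)] by simp
  have "(\<Sum>\<pi>\<in>Sym n. F \<pi> * of_nat (card (embeddings n V E \<pi>)))
      = (\<Sum>\<pi>\<in>Sym n. \<Sum>\<iota> | \<iota> \<in> ?I \<and> (\<forall>(x, y)\<in>E. \<pi> (\<iota> x) = \<iota> y). F \<pi>)"
    by (intro sum.cong refl) (simp add: embeddings_def mult.commute)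
  also have "\<dots> = (\<Sum>\<iota>\<in>?I. graph_sum F n E \<iota>)"
    unfolding graph_sum_def by (rule sum.swap_restrict[OF finite_Sym fin])
  also have "\<dots> = (\<Sum>\<iota>\<in>?I. graph_sum F n E f)"
  proof (intro sum.cong refl)
    fix \<iota> assume "\<iota> \<in> ?I"
    then have "inj_on \<iota> V" "\<iota> ` V \<subseteq> {1..n}" by (auto simp: PiE_iff)
    then show "graph_sum F n E \<iota> = graph_sum F n E f"
      using V by (intro graph_sum_cong[OF F]) auto
  qed
  also have "\<dots> = fact n / fact (n - card V) * graph_sum F n E f"
    by (simp add: card_injections[OF V(1) card])
  finally show ?thesis by (simp add: emb_avg_def)
qed

lemma emb_avg_eq_0:
  assumes "finite V" "n < card V"
  shows "emb_avg F n V E = 0"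
proof -
  have "embeddings n V E \<pi> = {}" for \<pi>
  proof -
    have "\<not> (inj_on \<iota> V \<and> \<iota> ` V \<subseteq> {1..n})" for \<iota>
      using card_inj_on_le[of \<iota> V "{1..n}"] assms by auto
    then show ?thesis by (auto simp: embeddings_def PiE_iff image_subset_iff)
  qed
  then show ?thesis by (simp add: emb_avg_def)
qed

text \<open>An embedding of \<open>V\<close> extends to a source \<open>v\<close> with edge \<open>(v, u)\<close> in the only way
  \<open>v \<mapsto> inv \<pi> (\<iota> u)\<close>, unless this value is already taken by some \<open>w \<in> V\<close>.\<close>

lemma card_embeddings_source:
  assumes "finite V" "Field E \<subseteq> V" "u \<in> V" "v \<notin> V" and p: "\<pi> \<in> Sym n"
  shows "card (embeddings n (insert v V) (insert (v, u) E) \<pi>)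
    + (\<Sum>w\<in>V. card (embeddings n V (insert (w, u) E) \<pi>)) = card (embeddings n V E \<pi>)"
proof -
  have pinv: "\<pi> (inv \<pi> x) = x" "inv \<pi> (\<pi> x) = x" for x using p by (simp_all add: permutes_inverses)
  have p_in: "inv \<pi> x \<in> {1..n} \<longleftrightarrow> x \<in> {1..n}" for x
    using permutes_in_image[of "inv \<pi>" "{1..n}" x] Sym_inv[OF p] by simp
  have EV: "x \<in> V" "y \<in> V" "x \<noteq> v" "y \<noteq> v" if "(x, y) \<in> E" for x y
    using assms(2,4) that by (auto simp: Field_def)
  have uv: "u \<noteq> v" using assms by blast
  let ?A = "{\<iota> \<in> embeddings n V E \<pi>. inv \<pi> (\<iota> u) \<notin> \<iota> ` V}"
  let ?B = "\<lambda>w. embeddings n V (insert (w, u) E) \<pi>"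
  have "bij_betw (\<lambda>\<iota>. \<iota>(v := inv \<pi> (\<iota> u))) ?A (embeddings n (insert v V) (insert (v, u) E) \<pi>)"
  proof (rule bij_betw_byWitness[where f' = "\<lambda>\<iota>. \<iota>(v := undefined)"])
    show "\<forall>\<iota>\<in>?A. (\<iota>(v := inv \<pi> (\<iota> u)))(v := undefined) = \<iota>"
      using assms(4) by (auto simp: embeddings_def fun_eq_iff PiE_iff extensional_def)
    show "\<forall>\<iota>\<in>embeddings n (insert v V) (insert (v, u) E) \<pi>.
        (\<iota>(v := undefined))(v := inv \<pi> ((\<iota>(v := undefined)) u)) = \<iota>"
    proof
      fix \<iota> assume "\<iota> \<in> embeddings n (insert v V) (insert (v, u) E) \<pi>"
      then have "\<pi> (\<iota> v) = \<iota> u" by (simp add: embeddings_def)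
      then have "inv \<pi> (\<iota> u) = \<iota> v" using pinv(2)[of "\<iota> v"] by simp
      then show "(\<iota>(v := undefined))(v := inv \<pi> ((\<iota>(v := undefined)) u)) = \<iota>"
        using uv by (simp add: fun_eq_iff)
    qed
    show "(\<lambda>\<iota>. \<iota>(v := inv \<pi> (\<iota> u))) ` ?A \<subseteq> embeddings n (insert v V) (insert (v, u) E) \<pi>"
    proof (intro image_subsetI)
      fix \<iota> assume i: "\<iota> \<in> ?A"
      then have i': "\<iota> \<in> V \<rightarrow>\<^sub>E {1..n}" "inj_on \<iota> V" "\<And>x y. (x, y) \<in> E \<Longrightarrow> \<pi> (\<iota> x) = \<iota> y" "inv \<pi> (\<iota> u) \<notin> \<iota> ` V"
        by (auto simp: embeddings_def)
      let ?j = "\<iota>(v := inv \<pi> (\<iota> u))"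
      have "\<iota> u \<in> {1..n}" using i'(1) assms(3) by auto
      then have "inv \<pi> (\<iota> u) \<in> {1..n}" using p_in by blast
      then have "?j \<in> insert v V \<rightarrow>\<^sub>E {1..n}" using i'(1) by (intro PiE_fun_upd)
      moreover have "inj_on ?j (insert v V)"
      proof -
        have "?j ` V = \<iota> ` V" "inj_on ?j V = inj_on \<iota> V" using assms(4) by (auto intro!: inj_on_cong image_cong)
        then show ?thesis using i' assms(4) by (simp add: inj_on_insert)
      qed
      moreover have "\<pi> (?j x) = ?j y" if "(x, y) \<in> insert (v, u) E" for x y
        using that EV[of x y] i'(3) uv pinv by auto
      ultimately show "?j \<in> embeddings n (insert v V) (insert (v, u) E) \<pi>"
        unfolding embeddings_def by blast
    qed
    show "(\<lambda>\<iota>. \<iota>(v := undefined)) ` embeddings n (insert v V) (insert (v, u) E) \<pi> \<subseteq> ?A"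
    proof (intro image_subsetI)
      fix \<iota> assume "\<iota> \<in> embeddings n (insert v V) (insert (v, u) E) \<pi>"
      then have i: "\<iota> \<in> insert v V \<rightarrow>\<^sub>E {1..n}" "inj_on \<iota> (insert v V)" "\<pi> (\<iota> v) = \<iota> u"
        "\<And>x y. (x, y) \<in> E \<Longrightarrow> \<pi> (\<iota> x) = \<iota> y"
        by (auto simp: embeddings_def)
      let ?j = "\<iota>(v := undefined)"
      have im: "?j ` V = \<iota> ` V" and inj: "inj_on ?j V = inj_on \<iota> V"
        using assms(4) by (auto intro!: inj_on_cong image_cong)
      have "inv \<pi> (?j u) = \<iota> v" using i(3) pinv(2)[of "\<iota> v"] uv by simp
      moreover have "\<iota> v \<notin> \<iota> ` V" using i(2) assms(4) by (auto simp: inj_on_def)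
      moreover have "?j \<in> V \<rightarrow>\<^sub>E {1..n}" using i(1) assms(4) by (rule fun_upd_in_PiE[rotated])
      moreover have "inj_on ?j V" unfolding inj using i(2) by (simp add: inj_on_insert)
      moreover have "\<pi> (?j x) = ?j y" if "(x, y) \<in> E" for x y
        using that EV[of x y] i(4) by simp
      ultimately show "?j \<in> ?A" unfolding embeddings_def mem_Collect_eq im by auto
    qed
  qed
  then have A: "card (embeddings n (insert v V) (insert (v, u) E) \<pi>) = card ?A"
    by (simp add: bij_betw_same_card)
  have fin: "finite (embeddings n V E' \<pi>)" for E' by (rule finite_embeddings[OF assms(1)])
  have B: "?B w = {\<iota> \<in> embeddings n V E \<pi>. \<iota> w = inv \<pi> (\<iota> u)}" for w
  proof -
    have "\<pi> x = y \<longleftrightarrow> x = inv \<pi> y" for x y using pinv by metis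
    then show ?thesis by (auto simp: embeddings_def)
  qed
  \<comment> \<open>An embedding takes each value at most once, so the vertex w occupying the
    required value is unique. The case w = u is included and corresponds to a loop.\<close>
  have "(\<Sum>w\<in>V. card (?B w)) = card (\<Union>w\<in>V. ?B w)"
  proof (rule card_UN_disjoint[symmetric])
    show "\<forall>i\<in>V. \<forall>j\<in>V. i \<noteq> j \<longrightarrow> ?B i \<inter> ?B j = {}"
      unfolding B by (auto simp: embeddings_def inj_on_def)
  qed (use assms(1) fin in auto)
  also have "(\<Union>w\<in>V. ?B w) = embeddings n V E \<pi> - ?A"
    unfolding B by (auto simp: image_iff eq_commute)
  also have "card \<dots> = card (embeddings n V E \<pi>) - card ?A"
    by (rule card_Diff_subset) (auto intro: finite_subset[OF _ fin])
  finally show ?thesis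
    using A card_mono[OF fin, of ?A] by auto
qed

lemma card_embeddings_isolated:
  assumes "finite V" "Field E \<subseteq> V" "u \<notin> V"
  shows "card (embeddings n (insert u V) E \<pi>) = (n - card V) * card (embeddings n V E \<pi>)"
proof -
  have EV: "x \<noteq> u" "y \<noteq> u" if "(x, y) \<in> E" for x y
    using assms(2,3) that by (auto simp: Field_def)
  have "bij_betw (\<lambda>(\<iota>, y). \<iota>(u := y)) (SIGMA \<iota>:embeddings n V E \<pi>. {1..n} - \<iota> ` V) (embeddings n (insert u V) E \<pi>)"
  proof (rule bij_betw_byWitness[where f' = "\<lambda>\<iota>. (\<iota>(u := undefined), \<iota> u)"])
    show "\<forall>a\<in>SIGMA \<iota>:embeddings n V E \<pi>. {1..n} - \<iota> ` V.
        (((case a of (\<iota>, y) \<Rightarrow> \<iota>(u := y))(u := undefined)), (case a of (\<iota>, y) \<Rightarrow> \<iota>(u := y)) u) = a"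
      using assms(3) by (auto simp: embeddings_def fun_eq_iff PiE_iff extensional_def)
    show "(\<lambda>(\<iota>, y). \<iota>(u := y)) ` (SIGMA \<iota>:embeddings n V E \<pi>. {1..n} - \<iota> ` V) \<subseteq> embeddings n (insert u V) E \<pi>"
    proof (intro image_subsetI, clarify)
      fix \<iota> y assume i: "\<iota> \<in> embeddings n V E \<pi>" and y: "y \<in> {1..n}" "y \<notin> \<iota> ` V"
      then have i': "\<iota> \<in> V \<rightarrow>\<^sub>E {1..n}" "inj_on \<iota> V" "\<And>x y. (x, y) \<in> E \<Longrightarrow> \<pi> (\<iota> x) = \<iota> y"
        by (auto simp: embeddings_def)
      let ?j = "\<iota>(u := y)"
      have "?j \<in> insert u V \<rightarrow>\<^sub>E {1..n}" using i'(1) y by (intro PiE_fun_upd)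
      moreover have "inj_on ?j (insert u V)"
      proof -
        have "?j ` V = \<iota> ` V" "inj_on ?j V = inj_on \<iota> V" using assms(3) by (auto intro!: inj_on_cong image_cong)
        then show ?thesis using i' assms(3) y by (simp add: inj_on_insert)
      qed
      moreover have "\<pi> (?j x) = ?j y" if "(x, y) \<in> E" for x y
        using that EV[of x y] i'(3) by auto
      ultimately show "?j \<in> embeddings n (insert u V) E \<pi>"
        unfolding embeddings_def by blast
    qed
    show "(\<lambda>\<iota>. (\<iota>(u := undefined), \<iota> u)) ` embeddings n (insert u V) E \<pi>
        \<subseteq> (SIGMA \<iota>:embeddings n V E \<pi>. {1..n} - \<iota> ` V)"
    proof (intro image_subsetI)
      fix \<iota> assume "\<iota> \<in> embeddings n (insert u V) E \<pi>"
      then have i: "\<iota> \<in> insert u V \<rightarrow>\<^sub>E {1..n}" "inj_on \<iota> (insert u V)"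
        "\<And>x y. (x, y) \<in> E \<Longrightarrow> \<pi> (\<iota> x) = \<iota> y"
        by (auto simp: embeddings_def)
      let ?j = "\<iota>(u := undefined)"
      have im: "?j ` V = \<iota> ` V" and inj: "inj_on ?j V = inj_on \<iota> V"
        using assms(3) by (auto intro!: inj_on_cong image_cong)
      have "\<iota> u \<notin> \<iota> ` V" using i(2) assms(3) by (auto simp: inj_on_def)
      moreover have "\<iota> u \<in> {1..n}" using i(1) by auto
      moreover have "?j \<in> V \<rightarrow>\<^sub>E {1..n}" using i(1) assms(3) by (rule fun_upd_in_PiE[rotated])
      moreover have "inj_on ?j V" unfolding inj using i(2) by (simp add: inj_on_insert)
      moreover have "\<pi> (?j x) = ?j y" if "(x, y) \<in> E" for x y
        using that EV[of x y] i(3) by simp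
      ultimately show "(?j, \<iota> u) \<in> (SIGMA \<iota>:embeddings n V E \<pi>. {1..n} - \<iota> ` V)"
        unfolding embeddings_def mem_Sigma_iff mem_Collect_eq im by auto
    qed
  qed auto
  then have "card (embeddings n (insert u V) E \<pi>) = card (SIGMA \<iota>:embeddings n V E \<pi>. {1..n} - \<iota> ` V)"
    by (simp add: bij_betw_same_card)
  also have "\<dots> = (\<Sum>\<iota>\<in>embeddings n V E \<pi>. card ({1..n} - \<iota> ` V))"
    by (intro card_SigmaI finite_embeddings assms(1)) auto
  also have "\<dots> = (\<Sum>\<iota>\<in>embeddings n V E \<pi>. n - card V)"
  proof (intro sum.cong refl)
    fix \<iota> assume "\<iota> \<in> embeddings n V E \<pi>"
    then have "inj_on \<iota> V" "\<iota> ` V \<subseteq> {1..n}" by (auto simp: embeddings_def PiE_iff)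
    then show "card ({1..n} - \<iota> ` V) = n - card V"
      using assms(1) by (simp add: card_Diff_subset card_image)
  qed
  finally show ?thesis by simp
qed

lemma emb_avg_source:
  assumes "finite V" "Field E \<subseteq> V" "u \<in> V" "v \<notin> V"
  shows "emb_avg F n (insert v V) (insert (v, u) E)
    = emb_avg F n V E - (\<Sum>w\<in>V. emb_avg F n V (insert (w, u) E))"
proof -
  have "F \<pi> * of_nat (card (embeddings n (insert v V) (insert (v, u) E) \<pi>)) =
      F \<pi> * of_nat (card (embeddings n V E \<pi>)) - (\<Sum>w\<in>V. F \<pi> * of_nat (card (embeddings n V (insert (w, u) E) \<pi>)))"
    if "\<pi> \<in> Sym n" for \<pi>
    unfolding card_embeddings_source[OF assms that, symmetric]
    by (simp add: algebra_simps sum_distrib_left)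
  then show ?thesis
    by (simp add: emb_avg_def diff_divide_distrib sum_subtractf sum_divide_distrib[symmetric])
      (subst sum.swap, rule refl)
qed

lemma emb_avg_isolated:
  assumes "finite V" "Field E \<subseteq> V" "u \<notin> V"
  shows "emb_avg F n (insert u V) E = (of_nat n - of_nat (card V)) * emb_avg F n V E"
proof (cases "card V \<le> n")
  case True
  then show ?thesis
    by (simp add: emb_avg_def card_embeddings_isolated[OF assms] of_nat_diff sum_distrib_left algebra_simps)
next
  \<comment> \<open>The truncated difference and the complex one disagree here, but there are no
    embeddings at all, so both sides vanish.\<close>
  case False
  then show ?thesis using assms by (simp add: emb_avg_eq_0)
qed

section \<open>Polynomiality\<close>

text \<open>The invariant of the induction, with m an upper bound for the number of edges. Stating
  the degree bound additively forces a = 0 when m < |lam|. Both the degree bound and the threshold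
  weaken as m grows, so graphs with different numbers of edges can be combined.\<close>

definition stably_poly :: "nat list \<Rightarrow> nat \<Rightarrow> (nat \<Rightarrow> complex) \<Rightarrow> bool" where
  "stably_poly lam m A \<longleftrightarrow> (\<exists>a. (a \<noteq> 0 \<longrightarrow> degree a + sum_list lam \<le> m) \<and>
     (\<forall>n \<ge> m + sum_list lam. is_partition_of (pad_partition n lam) n \<longrightarrow> A n = poly a (of_nat n)))"

lemma stably_poly_cong:
  assumes "stably_poly lam m A"
    and "\<And>n. n \<ge> m + sum_list lam \<Longrightarrow> is_partition_of (pad_partition n lam) n \<Longrightarrow> B n = A n"
  shows "stably_poly lam m B"
  using assms unfolding stably_poly_def by metis

lemma stably_poly_mono: "stably_poly lam m A \<Longrightarrow> m \<le> m' \<Longrightarrow> stably_poly lam m' A"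
  unfolding stably_poly_def by (metis add_le_mono1 le_trans)

lemma stably_poly_0: "stably_poly lam m (\<lambda>n. 0)"
  unfolding stably_poly_def by (intro exI[of _ 0]) simp

lemma stably_poly_add:
  assumes "stably_poly lam m A" "stably_poly lam m B"
  shows "stably_poly lam m (\<lambda>n. A n + B n)"
proof -
  obtain a b where ab: "a \<noteq> 0 \<longrightarrow> degree a + sum_list lam \<le> m" "b \<noteq> 0 \<longrightarrow> degree b + sum_list lam \<le> m"
    "\<forall>n \<ge> m + sum_list lam. is_partition_of (pad_partition n lam) n \<longrightarrow> A n = poly a (of_nat n)"
    "\<forall>n \<ge> m + sum_list lam. is_partition_of (pad_partition n lam) n \<longrightarrow> B n = poly b (of_nat n)"
    using assms unfolding stably_poly_def by auto
  have "degree (a + b) + sum_list lam \<le> m" if "a + b \<noteq> 0"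
  proof (cases "a = 0 \<or> b = 0")
    case False
    then show ?thesis using degree_add_le_max[of a b] ab(1,2) by auto
  qed (use ab that in auto)
  then show ?thesis unfolding stably_poly_def using ab(3,4) by (intro exI[of _ "a + b"]) simp
qed

lemma stably_poly_cmult:
  assumes "stably_poly lam m A"
  shows "stably_poly lam m (\<lambda>n. c * A n)"
proof -
  obtain a where a: "a \<noteq> 0 \<longrightarrow> degree a + sum_list lam \<le> m"
    "\<forall>n \<ge> m + sum_list lam. is_partition_of (pad_partition n lam) n \<longrightarrow> A n = poly a (of_nat n)"
    using assms unfolding stably_poly_def by auto
  then show ?thesis
    unfolding stably_poly_def by (intro exI[of _ "smult c a"]) auto
qed

text \<open>The exact counterpart of losing an edge: the linear factor from an isolated vertex
  raises the degree by one, and the lost edge had left room for one.\<close>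

lemma stably_poly_linear:
  assumes "stably_poly lam m A"
  shows "stably_poly lam (Suc m) (\<lambda>n. (of_nat n - c) * A n)"
proof -
  obtain a where a: "a \<noteq> 0 \<longrightarrow> degree a + sum_list lam \<le> m"
    "\<forall>n \<ge> m + sum_list lam. is_partition_of (pad_partition n lam) n \<longrightarrow> A n = poly a (of_nat n)"
    using assms unfolding stably_poly_def by auto
  have "degree ([:- c, 1:] * a) \<le> Suc (degree a)"
    using degree_mult_le[of "[:- c, 1:]" a] by simp
  then show ?thesis
    unfolding stably_poly_def using a by (intro exI[of _ "[:- c, 1:] * a"]) (auto simp: algebra_simps)
qed

lemma stably_poly_sum:
  assumes "\<And>i. i \<in> I \<Longrightarrow> stably_poly lam m (A i)"
  shows "stably_poly lam m (\<lambda>n. \<Sum>i\<in>I. A i n)"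
  using assms
  by (induction I rule: infinite_finite_induct) (auto simp: stably_poly_0 intro!: stably_poly_add)

lemma stably_poly_diff:
  assumes "stably_poly lam m A" "stably_poly lam m B"
  shows "stably_poly lam m (\<lambda>n. A n - B n)"
  using stably_poly_add[OF assms(1) stably_poly_cmult[OF assms(2), of "-1"]] by simp

text \<open>Below |lam| the trace vanishes; from s = |lam| on it is a constant polynomial, whose
  degree 0 meets the bound s - |lam|.\<close>

lemma stably_poly_ext_char_avg:
  assumes lam: "is_partition lam" and g: "\<gamma> \<in> Sym s"
  shows "stably_poly lam s (\<lambda>n. ext_char_avg lam n s \<gamma>)"
proof -
  define m where "m = Max (insert 0 (set lam))"
  have parts: "z \<le> m" if "z \<in> set lam" for z
    using that by (simp add: m_def)
  have "m \<in> insert 0 (set lam)" unfolding m_def by (rule Max_in) auto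
  then have m: "m \<le> sum_list lam" using member_le_sum_list by auto
  have valid: "sum_list lam \<le> n" "m \<le> n - sum_list lam" if "is_partition_of (pad_partition n lam) n" for n
  proof -
    show "sum_list lam \<le> n"
      using that by (simp add: is_partition_of_def pad_partition_def)
    show "m \<le> n - sum_list lam"
      using that \<open>m \<in> insert 0 (set lam)\<close>
      by (auto simp: is_partition_of_def is_partition_def pad_partition_def)
  qed
  show ?thesis
  proof (cases "s < sum_list lam")
    case True
    then have "ext_char_avg lam n s \<gamma> = 0" if "is_partition_of (pad_partition n lam) n" for n
      using ext_char_avg_eq_0[OF parts valid[OF that] True g] by simp
    then show ?thesis by (intro stably_poly_cong[OF stably_poly_0])
  next
    case False
    \<comment> \<open>The least n satisfying both n - |lam| \<ge> m, which makes lam[n] a partition,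
      and n \<ge> s + |lam|, which is the stable range.\<close>
    define N where "N = sum_list lam + max s m"
    have const: "ext_char_avg lam n s \<gamma> = ext_char_avg lam N s \<gamma>" if "N \<le> n" for n
      using that
    proof (induction n rule: dec_induct)
      case (step n)
      have "ext_char_avg lam (Suc n) s \<gamma> = ext_char_avg lam n s \<gamma>"
        using step(1) by (intro ext_char_avg_Suc[OF parts _ _ _ m g]) (auto simp: N_def)
      then show ?case using step by simp
    qed simp
    have "ext_char_avg lam n s \<gamma> = poly [:ext_char_avg lam N s \<gamma>:] (of_nat n)"
      if "s + sum_list lam \<le> n" "is_partition_of (pad_partition n lam) n" for n
      using const[of n] valid[OF that(2)] that(1) by (simp add: N_def)
    then show ?thesis
      unfolding stably_poly_def using False by (intro exI[of _ "[:ext_char_avg lam N s \<gamma>:]"]) auto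
  qed
qed

lemma irr_char_pad_conj:
  assumes "sum_list (pad_partition n lam) = n" "\<tau> \<in> Sym n" "\<pi> \<in> Sym n"
  shows "irr_char (pad_partition n lam) (\<tau> \<circ> \<pi> \<circ> inv \<tau>) = irr_char (pad_partition n lam) \<pi>"
  using irr_char_conj[of \<tau> "pad_partition n lam" \<pi>] assms by simp

text \<open>A single-valued relation without sources is the graph of a permutation of its field.\<close>

lemma stably_poly_emb_avg_permutation:
  fixes E :: "('a \<times> 'a) set"
  assumes lam: "is_partition lam" and E: "finite E" "single_valued E" "Field E \<subseteq> Range E"
  shows "stably_poly lam (card E) (\<lambda>n. emb_avg (irr_char (pad_partition n lam)) n (Field E) E)"
proof -
  let ?V = "Field E"
  have fin: "finite ?V" "finite (Domain E)" using E(1) by (auto simp: finite_Field finite_Domain)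
  define f where "f = (\<lambda>x. THE y. (x, y) \<in> E)"
  have f: "f x = y" if "(x, y) \<in> E" for x y
    unfolding f_def using that E(2) by (auto simp: single_valued_def)
  have imf: "f ` Domain E = Range E" using f by (force simp: image_iff)
  have "Range E = ?V" using E(3) by (auto simp: Field_def)
  \<comment> \<open>The function f maps the domain onto the range, which is all of
    \<open>?V\<close>. Comparing cardinalities, every vertex has an outgoing edge and f is a
    bijection.\<close>
  have "card ?V \<le> card (Domain E)" using card_image_le[OF fin(2), of f] imf \<open>Range E = ?V\<close> by simp
  then have dom: "Domain E = ?V"
    using card_subset_eq[OF fin(1), of "Domain E"] card_mono[OF fin(1), of "Domain E"] by (auto simp: Field_def)
  have bij: "bij_betw f ?V ?V"
    unfolding bij_betw_def using imf dom \<open>Range E = ?V\<close> fin(1) by (metis eq_card_imp_inj_on)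
  have Ef: "E = (\<lambda>x. (x, f x)) ` ?V"
    using f dom by (force simp: image_iff)
  have "inj_on (\<lambda>x. (x, f x)) ?V" by (auto simp: inj_on_def)
  then have cardE: "card E = card ?V"
    by (rule trans[OF arg_cong[OF Ef, of card] card_image])
  define s where "s = card ?V"
  have "\<exists>h. bij_betw h ?V {1..s}"
    by (rule finite_same_card_bij) (simp_all add: fin s_def)
  then obtain h where h: "bij_betw h ?V {1..s}" ..
  \<comment> \<open>The bijection f transported to {1..s} by the numbering h. The permutations
    realizing the placement h are then exactly the extensions of \<gamma>.\<close>
  define \<gamma> where "\<gamma> = (\<lambda>i. if i \<in> {1..s} then h (f (inv_into ?V h i)) else i)"
  have "bij_betw (h \<circ> (f \<circ> inv_into ?V h)) {1..s} {1..s}"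
    by (rule bij_betw_trans[OF bij_betw_trans[OF bij_betw_inv_into[OF h] bij] h])
  then have "bij_betw \<gamma> {1..s} {1..s}"
    by (rule iffD1[OF bij_betw_cong, rotated]) (simp add: \<gamma>_def)
  then have "\<gamma> permutes {1..s}"
    by (rule bij_imp_permutes) (auto simp: \<gamma>_def)
  then have g: "\<gamma> \<in> Sym s" by simp
  have gh: "\<gamma> (h x) = h (f x)" if "x \<in> ?V" for x
    using that h bij_betwE[OF h] bij_betw_inv_into_left[OF h that] by (simp add: \<gamma>_def)
  have "emb_avg (irr_char (pad_partition n lam)) n ?V E = ext_char_avg lam n s \<gamma>"
    if n: "card E + sum_list lam \<le> n" "is_partition_of (pad_partition n lam) n" for n
  proof -
    have sn: "s \<le> n" using n(1) cardE by (simp add: s_def)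
    have "{\<pi> \<in> Sym n. \<forall>(x, y)\<in>E. \<pi> (h x) = h y} = extensions n s \<gamma>"
    proof -
      have "(\<forall>(x, y)\<in>E. \<pi> (h x) = h y) \<longleftrightarrow> (\<forall>x\<in>?V. \<pi> (h x) = \<gamma> (h x))" for \<pi>
      proof -
        have "(\<forall>p\<in>E. case p of (x, y) \<Rightarrow> \<pi> (h x) = h y) \<longleftrightarrow>
            (\<forall>p\<in>(\<lambda>x. (x, f x)) ` ?V. case p of (x, y) \<Rightarrow> \<pi> (h x) = h y)"
          using Ef by (rule arg_cong)
        then show ?thesis by (simp add: gh)
      qed
      moreover have "h ` ?V = {1..s}" using h by (simp add: bij_betw_def)
      ultimately have eq: "(\<forall>(x, y)\<in>E. \<pi> (h x) = h y) \<longleftrightarrow> (\<forall>i\<in>{1..s}. \<pi> i = \<gamma> i)" for \<pi>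
        using ball_simps(9)[of h ?V "\<lambda>i. \<pi> i = \<gamma> i"] by simp
      show ?thesis unfolding extensions_def eq by (rule refl)
    qed
    then have "graph_sum (irr_char (pad_partition n lam)) n E h / fact (n - s) = ext_char_avg lam n s \<gamma>"
      by (simp add: graph_sum_def ext_char_avg_def)
    moreover have "h ` ?V \<subseteq> {1..n}" "inj_on h ?V" using h sn by (auto simp: bij_betw_def)
    ultimately show ?thesis
      using n(2) by (subst emb_avg_graph_sum[OF irr_char_pad_conj fin(1) order_refl])
        (auto simp: is_partition_of_def s_def)
  qed
  then show ?thesis
    using stably_poly_cong[OF stably_poly_ext_char_avg[OF lam g]] cardE by (simp add: s_def)
qed

text \<open>Two arrows from one vertex would force a permutation to take two values at one point, as
  embeddings are injective.\<close>

lemma emb_avg_not_single_valued: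
  assumes "\<not> single_valued E"
  shows "emb_avg F n (Field E) E = 0"
proof -
  obtain x y z where E: "(x, y) \<in> E" "(x, z) \<in> E" "y \<noteq> z" using assms by (auto simp: single_valued_def)
  have "embeddings n (Field E) E \<pi> = {}" for \<pi>
  proof (rule equals0I)
    fix \<iota> assume "\<iota> \<in> embeddings n (Field E) E \<pi>"
    then have "inj_on \<iota> (Field E)" and *: "\<And>x y. (x, y) \<in> E \<Longrightarrow> \<pi> (\<iota> x) = \<iota> y"
      by (auto simp: embeddings_def)
    moreover have "\<iota> y = \<iota> z" using *[OF E(1)] *[OF E(2)] by simp
    ultimately show False using E by (auto simp: inj_on_def Field_def)
  qed
  then show ?thesis by (simp add: emb_avg_def)
qed

text \<open>The induction is on the number of vertices, not of edges: the correction terms replace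
  the edge from the deleted source v by an edge from some w in V, so they may have as many edges as
  before but one vertex less.\<close>

lemma stably_poly_emb_avg:
  assumes lam: "is_partition lam" and "finite E"
  shows "stably_poly lam (card E) (\<lambda>n. emb_avg (irr_char (pad_partition n lam)) n (Field E) E)"
  using assms(2)
proof (induction "card (Field E)" arbitrary: E rule: less_induct)
  case less
  let ?A = "\<lambda>V E n. emb_avg (irr_char (pad_partition n lam)) n V E"
  show ?case
  proof (cases "single_valued E \<and> \<not> Field E \<subseteq> Range E")
    case False
    then show ?thesis
      using stably_poly_emb_avg_permutation[OF lam less.prems] stably_poly_0
      by (cases "single_valued E") (auto simp: emb_avg_not_single_valued)
  next
    case True
    then obtain v where v: "v \<in> Field E" "v \<notin> Range E" by blast
    then obtain u where vu: "(v, u) \<in> E" by (auto simp: Field_def)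
    define E' where "E' = E - {(v, u)}"
    define V where "V = Field E - {v}"
    have E: "E = insert (v, u) E'" and E'fin: "finite E'"
      using vu less.prems by (auto simp: E'_def)
    have cardE: "card E = Suc (card E')"
      unfolding E'_def by (rule card_Suc_Diff1[OF less.prems vu, symmetric])
    have FE: "Field E = insert v V" and vV: "v \<notin> V" and finV: "finite V"
      using v less.prems by (auto simp: V_def finite_Field)
    have uV: "u \<in> V" using v vu by (auto simp: V_def Field_def)
    \<comment> \<open>No edge enters v, and single-valuedness leaves (v, u) as the only edge out of
      v, so without it v is isolated.\<close>
    have E'V: "Field E' \<subseteq> V"
    proof
      fix x assume "x \<in> Field E'"
      then have "x \<in> Field E" "x \<noteq> v"
        using v(2) vu True by (auto simp: E'_def Field_def single_valued_def)
      then show "x \<in> V" by (simp add: V_def)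
    qed
    have V: "V = insert u (Field E')"
      using FE E vV uV E'V by (auto simp: Field_def)
    have small: "card V < card (Field E)" using FE vV finV by simp
    have w: "stably_poly lam (card E) (?A V (insert (w, u) E'))" if "w \<in> V" for w
    proof -
      have F: "Field (insert (w, u) E') = V" using that V by (auto simp: Field_def)
      have "card (insert (w, u) E') \<le> card E" using E'fin cardE by (simp add: card_insert_if)
      moreover have "stably_poly lam (card (insert (w, u) E')) (?A V (insert (w, u) E'))"
        using less.hyps[of "insert (w, u) E'"] E'fin small unfolding F by simp
      ultimately show ?thesis by (rule stably_poly_mono[rotated])
    qed
    have "stably_poly lam (card E) (?A V E')"
    proof (cases "u \<in> Field E'")
      case True
      then have F: "Field E' = V" using V by auto
      have "stably_poly lam (card E') (?A V E')" using less.hyps[of E'] E'fin small unfolding F by simp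
      then show ?thesis by (rule stably_poly_mono) (simp add: cardE)
    next
      \<comment> \<open>The lost edge was the only one at u, so u is now isolated and gives the
        linear factor.\<close>
      case False
      have finE': "finite (Field E')" using E'fin by (rule finite_Field)
      have "card (Field E') \<le> card V" using E'V finV by (intro card_mono)
      then have "stably_poly lam (card E') (?A (Field E') E')"
        using less.hyps[of E'] E'fin small by simp
      then show ?thesis
        unfolding V cardE emb_avg_isolated[OF finE' order_refl False] by (rule stably_poly_linear)
    qed
    then show ?thesis
      unfolding FE using w
      by (subst E, subst emb_avg_source[OF finV E'V uV vV]) (intro stably_poly_diff stably_poly_sum)
  qed
qed

section \<open>Occurrences and their order types\<close>

lemma conj_class_subset: "\<pi> \<in> Sym n \<Longrightarrow> conj_class n \<pi> \<subseteq> Sym n"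
  unfolding conj_class_def using Sym_compose Sym_inv by blast

lemma conj_class_sym:
  assumes "\<pi> \<in> Sym n" "\<rho> \<in> conj_class n \<pi>"
  shows "\<pi> \<in> conj_class n \<rho>"
proof -
  obtain t where t: "t \<in> Sym n" "\<rho> = t \<circ> \<pi> \<circ> inv t" using assms(2) by (auto simp: conj_class_def)
  then have "\<pi> = inv t \<circ> \<rho> \<circ> inv (inv t)"
    by (simp add: Sym_inv_inv[OF t(1)] o_assoc[symmetric] Sym_cancel[OF t(1)] Sym_inv_o[OF t(1)])
  then show ?thesis unfolding conj_class_def using Sym_inv[OF t(1)] by blast
qed

lemma conj_class_trans:
  assumes "\<rho> \<in> conj_class n \<pi>" "\<phi> \<in> conj_class n \<rho>"
  shows "\<phi> \<in> conj_class n \<pi>"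
proof -
  obtain t u where t: "t \<in> Sym n" "\<rho> = t \<circ> \<pi> \<circ> inv t" and u: "u \<in> Sym n" "\<phi> = u \<circ> \<rho> \<circ> inv u"
    using assms by (auto simp: conj_class_def)
  then have "\<phi> = (u \<circ> t) \<circ> \<pi> \<circ> inv (u \<circ> t)"
    by (simp add: Sym_inv_compose[OF u(1) t(1)] o_assoc)
  then show ?thesis unfolding conj_class_def using Sym_compose[OF u(1) t(1)] by blast
qed

text \<open>Exchange the sums over pairs of conjugate permutations: each \<rho> is reached from all
  members of its class, each time with weight one over the size of the class.\<close>

lemma sum_conj_class_average:
  fixes F G :: "(nat \<Rightarrow> nat) \<Rightarrow> complex"
  assumes F: "\<And>\<tau> \<pi>. \<tau> \<in> Sym n \<Longrightarrow> \<pi> \<in> Sym n \<Longrightarrow> F (\<tau> \<circ> \<pi> \<circ> inv \<tau>) = F \<pi>"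
  shows "(\<Sum>\<pi>\<in>Sym n. F \<pi> * ((\<Sum>\<rho>\<in>conj_class n \<pi>. G \<rho>) / of_nat (card (conj_class n \<pi>))))
    = (\<Sum>\<pi>\<in>Sym n. F \<pi> * G \<pi>)"
proof -
  let ?c = "conj_class n"
  have cl: "?c \<rho> = ?c \<pi>" if "\<pi> \<in> Sym n" "\<rho> \<in> ?c \<pi>" for \<pi> \<rho>
    using conj_class_trans that(2) conj_class_trans[OF conj_class_sym[OF that]] by blast
  have FF: "F \<rho> = F \<pi>" if "\<pi> \<in> Sym n" "\<rho> \<in> ?c \<pi>" for \<pi> \<rho>
    using that F by (auto simp: conj_class_def)
  have mem: "\<rho> \<in> Sym n \<and> \<rho> \<in> ?c \<pi> \<longleftrightarrow> \<rho> \<in> ?c \<pi>" if "\<pi> \<in> Sym n" for \<pi> \<rho>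
    using conj_class_subset[OF that] by blast
  have nonempty: "of_nat (card (?c \<pi>)) \<noteq> (0 :: complex)" if "\<pi> \<in> Sym n" for \<pi>
  proof -
    have "\<pi> = id \<circ> \<pi> \<circ> inv id" by simp
    then have "\<pi> \<in> ?c \<pi>" unfolding conj_class_def by (metis (mono_tags, lifting) mem_Collect_eq permutes_id)
    moreover have "finite (?c \<pi>)" using conj_class_subset[OF that] finite_Sym by (rule finite_subset)
    ultimately show ?thesis by auto
  qed
  have "(\<Sum>\<pi>\<in>Sym n. F \<pi> * ((\<Sum>\<rho>\<in>?c \<pi>. G \<rho>) / of_nat (card (?c \<pi>))))
      = (\<Sum>\<pi>\<in>Sym n. \<Sum>\<rho>\<in>?c \<pi>. F \<rho> * G \<rho> / of_nat (card (?c \<rho>)))"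
    by (intro sum.cong refl) (simp add: sum_distrib_left sum_divide_distrib FF cl)
  also have "\<dots> = (\<Sum>\<pi>\<in>Sym n. \<Sum>\<rho> | \<rho> \<in> Sym n \<and> \<rho> \<in> ?c \<pi>. F \<rho> * G \<rho> / of_nat (card (?c \<rho>)))"
  proof (rule sum.cong[OF refl])
    fix \<pi> assume \<pi>: "\<pi> \<in> Sym n"
    have "{\<rho>. \<rho> \<in> Sym n \<and> \<rho> \<in> ?c \<pi>} = ?c \<pi>" using mem[OF \<pi>] by blast
    then show "(\<Sum>\<rho>\<in>?c \<pi>. F \<rho> * G \<rho> / of_nat (card (?c \<rho>)))
      = (\<Sum>\<rho> | \<rho> \<in> Sym n \<and> \<rho> \<in> ?c \<pi>. F \<rho> * G \<rho> / of_nat (card (?c \<rho>)))" by (simp only:)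
  qed
  also have "\<dots> = (\<Sum>\<rho>\<in>Sym n. \<Sum>\<pi> | \<pi> \<in> Sym n \<and> \<rho> \<in> ?c \<pi>. F \<rho> * G \<rho> / of_nat (card (?c \<rho>)))"
    by (rule sum.swap_restrict[OF finite_Sym finite_Sym])
  also have "\<dots> = (\<Sum>\<rho>\<in>Sym n. F \<rho> * G \<rho>)"
  proof (rule sum.cong[OF refl])
    fix \<rho> assume \<rho>: "\<rho> \<in> Sym n"
    have "{\<pi>. \<pi> \<in> Sym n \<and> \<rho> \<in> ?c \<pi>} = ?c \<rho>"
      using conj_class_sym conj_class_subset[OF \<rho>] \<rho> by blast
    then show "(\<Sum>\<pi> | \<pi> \<in> Sym n \<and> \<rho> \<in> ?c \<pi>. F \<rho> * G \<rho> / of_nat (card (?c \<rho>))) = F \<rho> * G \<rho>"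
      using nonempty[OF \<rho>] by simp
  qed
  finally show ?thesis .
qed

section \<open>Order-preserving numbering of a finite set of natural numbers\<close>

definition rank :: "nat set \<Rightarrow> nat \<Rightarrow> nat" where
  "rank S y = card {x \<in> S. x \<le> y}"

lemma rank_less_iff:
  assumes "finite S" "x \<in> S" "y \<in> S"
  shows "rank S x < rank S y \<longleftrightarrow> x < y"
proof -
  have "rank S a < rank S b" if "a < b" "b \<in> S" for a b
  proof -
    have "{x \<in> S. x \<le> a} \<subseteq> {x \<in> S. x \<le> b}" "b \<in> {x \<in> S. x \<le> b}" "b \<notin> {x \<in> S. x \<le> a}"
      using that by auto
    then have "{x \<in> S. x \<le> a} \<subset> {x \<in> S. x \<le> b}" by blast
    then show ?thesis unfolding rank_def using assms(1) by (intro psubset_card_mono) simp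
  qed
  moreover have "rank S a \<le> rank S b" if "a \<le> b" for a b
    unfolding rank_def using that assms(1) by (intro card_mono) auto
  ultimately show ?thesis using assms by (meson leD leI)
qed

lemma bij_betw_rank:
  assumes "finite S"
  shows "bij_betw (rank S) S {1..card S}"
proof -
  have inj: "inj_on (rank S) S"
  proof (rule inj_onI)
    fix x y assume "x \<in> S" "y \<in> S" "rank S x = rank S y"
    then show "x = y" using rank_less_iff[OF assms, of x y] rank_less_iff[OF assms, of y x] by (metis less_irrefl linorder_neqE_nat)
  qed
  have "rank S ` S \<subseteq> {1..card S}"
  proof (intro image_subsetI)
    fix x assume "x \<in> S"
    have "rank S x \<le> card S" unfolding rank_def using assms by (intro card_mono) auto
    moreover have "0 < rank S x"
      unfolding rank_def using assms \<open>x \<in> S\<close> by (intro card_gt_0_iff[THEN iffD2]) auto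
    ultimately show "rank S x \<in> {1..card S}" by simp
  qed
  moreover have "card (rank S ` S) = card {1..card S}" using card_image[OF inj] by simp
  ultimately show ?thesis
    unfolding bij_betw_def using inj card_subset_eq[of "{1..card S}"] by blast
qed

abbreviation unrank :: "nat set \<Rightarrow> nat \<Rightarrow> nat" where
  "unrank S \<equiv> inv_into S (rank S)"

lemma unrank:
  assumes "finite S"
  shows "inj_on (unrank S) {1..card S}" "unrank S ` {1..card S} = S"
    and "i \<in> {1..card S} \<Longrightarrow> rank S (unrank S i) = i"
    and "x \<in> S \<Longrightarrow> unrank S (rank S x) = x"
    and "i \<in> {1..card S} \<Longrightarrow> unrank S i \<in> S"
  using bij_betw_inv_into[OF bij_betw_rank[OF assms]] bij_betw_inv_into_right[OF bij_betw_rank[OF assms]]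
    bij_betw_inv_into_left[OF bij_betw_rank[OF assms]]
  by (auto simp: bij_betw_def)

lemma unrank_less_iff:
  assumes "finite S" "i \<in> {1..card S}" "j \<in> {1..card S}"
  shows "unrank S i < unrank S j \<longleftrightarrow> i < j"
  using rank_less_iff[OF assms(1) unrank(5)[OF assms(1,2)] unrank(5)[OF assms(1,3)]]
    unrank(3)[OF assms(1,2)] unrank(3)[OF assms(1,3)] by simp

text \<open>An assignment \<open>f\<close> records the positions and the values of a tuple of occurrences:
  \<open>f ((j, a), False)\<close> is the position of the \<open>a\<close>-th entry of the \<open>j\<close>-th occurrence and
  \<open>f ((j, a), True)\<close> is the value there.\<close>

context
  fixes d :: nat and k :: "nat \<Rightarrow> nat" and \<sigma> :: "nat \<Rightarrow> nat \<Rightarrow> nat"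
begin

definition slots :: "(nat \<times> nat) set" where
  "slots = (SIGMA j:{1..d}. {1..k j})"

definition matches :: "((nat \<times> nat) \<times> bool \<Rightarrow> nat) \<Rightarrow> bool" where
  "matches f \<longleftrightarrow> (\<forall>j\<in>{1..d}. \<forall>a\<in>{1..k j}. \<forall>b\<in>{1..k j}.
     (a < b \<longrightarrow> f ((j, a), False) < f ((j, b), False)) \<and>
     (f ((j, b), True) < f ((j, a), True) \<longleftrightarrow> \<sigma> j b < \<sigma> j a))"

text \<open>Positions and values are ranked in one common set, because conjugation moves a point of
  [n] as a position and as a value at once. So t also records which positions coincide with which
  values, and s is the number of distinct points, up to twice the number of slots.\<close>

definition order_types :: "nat \<Rightarrow> ((nat \<times> nat) \<times> bool \<Rightarrow> nat) set" where
  "order_types s = {t \<in> slots \<times> UNIV \<rightarrow>\<^sub>E {1..s}. t ` (slots \<times> UNIV) = {1..s} \<and> matches t}"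

text \<open>An arrow leads from each position to the value there. Slots that share position and
  value give one arrow, so there are at most as many edges as slots.\<close>

definition edges :: "((nat \<times> nat) \<times> bool \<Rightarrow> nat) \<Rightarrow> (nat \<times> nat) set" where
  "edges t = (\<lambda>x. (t (x, False), t (x, True))) ` slots"

lemma finite_slots: "finite slots" and card_slots: "card slots = (\<Sum>j=1..d. k j)"
  by (auto simp: slots_def)

lemma Field_edges: "Field (edges t) = t ` (slots \<times> UNIV)"
proof -
  have "t ` (slots \<times> UNIV) = (\<lambda>x. t (x, False)) ` slots \<union> (\<lambda>x. t (x, True)) ` slots"
    by (auto simp: UNIV_bool)
  then show ?thesis by (auto simp: edges_def Field_def Domain_fst Range_snd image_image)
qed

lemma matches_cong:
  assumes "\<And>z w. z \<in> slots \<times> UNIV \<Longrightarrow> w \<in> slots \<times> UNIV \<Longrightarrow> f z < f w \<longleftrightarrow> g z < g w"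
  shows "matches f \<longleftrightarrow> matches g"
proof -
  have *: "f ((j, a), c) < f ((j, b), c) \<longleftrightarrow> g ((j, a), c) < g ((j, b), c)"
    if "j \<in> {1..d}" "a \<in> {1..k j}" "b \<in> {1..k j}" for j a b c
    using that by (intro assms) (auto simp: slots_def)
  show ?thesis
    unfolding matches_def by (intro ball_cong refl) (simp only: *)
qed

text \<open>The values are determined by \<pi> and the positions. Carrying them along separates the
  pattern condition, which becomes the \<pi>-free predicate \<open>matches\<close>, from the
  condition that \<pi> maps positions to values.\<close>

lemma prod_num_occ:
  assumes "\<pi> \<in> Sym n"
  shows "(\<Prod>j=1..d. num_occ (k j) (\<sigma> j) n \<pi>) =
    card {f \<in> {f \<in> slots \<times> UNIV \<rightarrow>\<^sub>E {1..n}. matches f}. \<forall>x\<in>slots. \<pi> (f (x, False)) = f (x, True)}"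
proof -
  let ?O = "\<Pi>\<^sub>E j\<in>{1..d}. occurrences (k j) (\<sigma> j) n \<pi>"
  let ?B = "{f \<in> {f \<in> slots \<times> UNIV \<rightarrow>\<^sub>E {1..n}. matches f}. \<forall>x\<in>slots. \<pi> (f (x, False)) = f (x, True)}"
  let ?to = "\<lambda>e. \<lambda>z\<in>slots \<times> UNIV. case z of ((j, a), c) \<Rightarrow> if c then \<pi> (e j a) else e j a"
  let ?from = "\<lambda>f. \<lambda>j\<in>{1..d}. \<lambda>a\<in>{1..k j}. f ((j, a), False)"
  have p_in: "\<pi> x \<in> {1..n}" if "x \<in> {1..n}" for x
    using permutes_in_image[of \<pi> "{1..n}" x] assms that by simp
  have "bij_betw ?to ?O ?B"
  proof (rule bij_betw_byWitness[where f' = ?from])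
    show "\<forall>e\<in>?O. ?from (?to e) = e"
    proof
      fix e assume e: "e \<in> ?O"
      have "?from (?to e) j a = e j a" for j a
      proof (cases "j \<in> {1..d}")
        case True
        then have "e j \<in> {1..k j} \<rightarrow>\<^sub>E {1..n}" using e by (auto simp: occurrences_def)
        then show ?thesis using True by (cases "a \<in> {1..k j}") (auto simp: slots_def PiE_iff extensional_def)
      next
        case False
        then show ?thesis using e by (auto simp: PiE_iff extensional_def)
      qed
      then show "?from (?to e) = e" by (intro ext)
    qed
    show "\<forall>f\<in>?B. ?to (?from f) = f"
    proof
      fix f assume f: "f \<in> ?B"
      have "?to (?from f) z = f z" for z
      proof (cases "z \<in> slots \<times> UNIV")
        case True
        then obtain j a c where z: "z = ((j, a), c)" "(j, a) \<in> slots" by (cases z) auto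
        then have "\<pi> (f ((j, a), False)) = f ((j, a), True)" using f by blast
        then show ?thesis using z by (cases c) (auto simp: slots_def)
      next
        case False
        have "f \<in> extensional (slots \<times> UNIV)" using f by (simp add: PiE_def)
        from extensional_arb[OF this False] False show ?thesis by (simp only: restrict_def if_False)
      qed
      then show "?to (?from f) = f" by (intro ext)
    qed
    show "?to ` ?O \<subseteq> ?B"
    proof (intro image_subsetI)
      fix e assume e: "e \<in> ?O"
      have occ: "e j \<in> {1..k j} \<rightarrow>\<^sub>E {1..n}" "strict_mono_on {1..k j} (e j)"
        "\<And>a b. a \<in> {1..k j} \<Longrightarrow> b \<in> {1..k j} \<Longrightarrow> \<pi> (e j b) < \<pi> (e j a) \<longleftrightarrow> \<sigma> j b < \<sigma> j a"
        if "j \<in> {1..d}" for j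
        using PiE_mem[OF e that] by (auto simp: occurrences_def)
      have val: "?to e ((j, a), c) = (if c then \<pi> (e j a) else e j a)" if "j \<in> {1..d}" "a \<in> {1..k j}" for j a c
        using that by (simp add: slots_def)
      have "e j a \<in> {1..n}" if "j \<in> {1..d}" "a \<in> {1..k j}" for j a
        using PiE_mem[OF occ(1)[OF that(1)] that(2)] .
      then have "?to e \<in> slots \<times> UNIV \<rightarrow>\<^sub>E {1..n}"
        using p_in by (intro restrict_PiE_iff[THEN iffD2]) (auto simp: slots_def)
      moreover have "matches (?to e)"
        unfolding matches_def
      proof (intro ballI conjI impI)
        fix j a b assume j: "j \<in> {1..d}" and a: "a \<in> {1..k j}" and b: "b \<in> {1..k j}"
        show "?to e ((j, a), False) < ?to e ((j, b), False)" if "a < b"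
          unfolding val[OF j a] val[OF j b] using strict_mono_onD[OF occ(2)[OF j] a b that] by simp
        show "?to e ((j, b), True) < ?to e ((j, a), True) \<longleftrightarrow> \<sigma> j b < \<sigma> j a"
          unfolding val[OF j a] val[OF j b] using occ(3)[OF j a b] by simp
      qed
      moreover have "\<pi> (?to e (x, False)) = ?to e (x, True)" if "x \<in> slots" for x
        using that by (auto simp: slots_def)
      ultimately show "?to e \<in> ?B" by blast
    qed
    show "?from ` ?B \<subseteq> ?O"
    proof (intro image_subsetI)
      fix f assume "f \<in> ?B"
      then have f: "f \<in> slots \<times> UNIV \<rightarrow>\<^sub>E {1..n}" "matches f" "\<And>x. x \<in> slots \<Longrightarrow> \<pi> (f (x, False)) = f (x, True)"
        by auto
      have "(\<lambda>a\<in>{1..k j}. f ((j, a), False)) \<in> occurrences (k j) (\<sigma> j) n \<pi>" if j: "j \<in> {1..d}" for j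
        unfolding occurrences_def
      proof (intro CollectI conjI ballI)
        have sl: "(j, a) \<in> slots" if "a \<in> {1..k j}" for a using j that by (simp add: slots_def)
        show "(\<lambda>a\<in>{1..k j}. f ((j, a), False)) \<in> {1..k j} \<rightarrow>\<^sub>E {1..n}"
          using PiE_mem[OF f(1)] sl by (intro restrict_PiE_iff[THEN iffD2]) auto
        show "strict_mono_on {1..k j} (\<lambda>a\<in>{1..k j}. f ((j, a), False))"
        proof (rule strict_mono_onI)
          fix a b assume "a \<in> {1..k j}" "b \<in> {1..k j}" "a < b"
          then show "(\<lambda>a\<in>{1..k j}. f ((j, a), False)) a < (\<lambda>a\<in>{1..k j}. f ((j, a), False)) b"
            using f(2) j unfolding matches_def by simp
        qed
        fix a b assume ab: "a \<in> {1..k j}" "b \<in> {1..k j}"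
        then show "\<pi> ((\<lambda>a\<in>{1..k j}. f ((j, a), False)) b) < \<pi> ((\<lambda>a\<in>{1..k j}. f ((j, a), False)) a)
            \<longleftrightarrow> \<sigma> j b < \<sigma> j a"
          using f(2) j f(3)[OF sl[OF ab(1)]] f(3)[OF sl[OF ab(2)]] unfolding matches_def by simp
      qed
      then show "?from f \<in> ?O" by (intro restrict_PiE_iff[THEN iffD2]) blast
    qed
  qed
  then have "card ?O = card ?B" by (rule bij_betw_same_card)
  then show ?thesis by (simp only: card_PiE[OF finite_atLeastAtMost] num_occ_def)
qed

end

lemma sum_Pow_card:
  fixes g :: "nat \<Rightarrow> complex"
  assumes "finite A"
  shows "(\<Sum>S\<in>Pow A. g (card S)) = (\<Sum>s\<le>card A. of_nat (card A choose s) * g s)"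
proof -
  have "(\<Sum>S\<in>Pow A. g (card S)) = (\<Sum>s\<le>card A. \<Sum>S | S \<in> Pow A \<and> card S = s. g (card S))"
    using assms by (intro sum.group[symmetric]) (auto intro: card_mono)
  also have "\<dots> = (\<Sum>s\<le>card A. of_nat (card A choose s) * g s)"
  proof (intro sum.cong refl)
    fix s
    have "(\<Sum>S | S \<in> Pow A \<and> card S = s. g (card S)) = (\<Sum>S | S \<subseteq> A \<and> card S = s. g s)"
      by (rule sum.cong) auto
    then show "(\<Sum>S | S \<in> Pow A \<and> card S = s. g (card S)) = of_nat (card A choose s) * g s"
      using n_subsets[OF assms, of s] by simp
  qed
  finally show ?thesis .
qed

context
  fixes d :: nat and k :: "nat \<Rightarrow> nat" and \<sigma> :: "nat \<Rightarrow> nat \<Rightarrow> nat"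
begin

abbreviation "slot_ends \<equiv> slots d k \<times> (UNIV :: bool set)"

lemma finite_order_types: "finite (order_types d k \<sigma> s)"
proof -
  have "finite slot_ends" using finite_slots by simp
  then have "finite (slot_ends \<rightarrow>\<^sub>E {1..s})" by (intro finite_PiE) auto
  then show ?thesis by (rule rev_finite_subset) (auto simp: order_types_def)
qed

lemma order_types_empty:
  assumes "card slot_ends < s"
  shows "order_types d k \<sigma> s = {}"
proof -
  have "t ` slot_ends \<noteq> {1..s}" for t :: "(nat \<times> nat) \<times> bool \<Rightarrow> nat"
    using card_image_le[of slot_ends t] finite_slots assms by auto
  then show ?thesis by (auto simp: order_types_def)
qed

text \<open>An assignment is determined by its set of values together with its order type.\<close>

lemma sum_assignments:
  fixes C :: "((nat \<times> nat) \<times> bool \<Rightarrow> nat) \<Rightarrow> complex"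
  shows "(\<Sum>f\<in>{f \<in> slot_ends \<rightarrow>\<^sub>E {1..n}. matches d k \<sigma> f}. C f)
    = (\<Sum>S\<in>Pow {1..n}. \<Sum>t\<in>order_types d k \<sigma> (card S). C (\<lambda>z\<in>slot_ends. unrank S (t z)))"
proof -
  let ?A = "{f \<in> slot_ends \<rightarrow>\<^sub>E {1..n}. matches d k \<sigma> f}"
  let ?B = "SIGMA S:Pow {1..n}. order_types d k \<sigma> (card S)"
  have finS: "finite S" if "S \<in> Pow {1..n}" for S using that finite_subset by auto
  have "(\<Sum>f\<in>?A. C f) = (\<Sum>(S, t)\<in>?B. C (\<lambda>z\<in>slot_ends. unrank S (t z)))"
  proof (rule sum.reindex_bij_witness[of _ "\<lambda>(S, t). \<lambda>z\<in>slot_ends. unrank S (t z)" "\<lambda>f. (f ` slot_ends, \<lambda>z\<in>slot_ends. rank (f ` slot_ends) (f z))"])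
    fix f assume "f \<in> ?A"
    then have f: "f \<in> slot_ends \<rightarrow>\<^sub>E {1..n}" "matches d k \<sigma> f" by auto
    have S: "f ` slot_ends \<in> Pow {1..n}" using f(1) by auto
    note rk = bij_betw_rank[OF finS[OF S]]
    let ?t = "\<lambda>z\<in>slot_ends. rank (f ` slot_ends) (f z)"
    have ur: "unrank (f ` slot_ends) (?t z) = f z" if "z \<in> slot_ends" for z
      using unrank(4)[OF finS[OF S], of "f z"] that by simp
    show eq: "(case (f ` slot_ends, ?t) of (S, t) \<Rightarrow> \<lambda>z\<in>slot_ends. unrank S (t z)) = f"
    proof (rule ext)
      fix z
      show "(case (f ` slot_ends, ?t) of (S, t) \<Rightarrow> \<lambda>z\<in>slot_ends. unrank S (t z)) z = f z"
      proof (cases "z \<in> slot_ends")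
        case True
        then show ?thesis using ur by simp
      next
        case False
        have "f \<in> extensional slot_ends" using f(1) by (simp add: PiE_def)
        from extensional_arb[OF this False] False show ?thesis by simp
      qed
    qed
    show "(case (f ` slot_ends, ?t) of (S, t) \<Rightarrow> C (\<lambda>z\<in>slot_ends. unrank S (t z))) = C f"
      using eq by simp
    have "?t \<in> slot_ends \<rightarrow>\<^sub>E {1..card (f ` slot_ends)}"
      using bij_betwE[OF rk] by (intro restrict_PiE_iff[THEN iffD2]) blast
    moreover have "?t ` slot_ends = {1..card (f ` slot_ends)}"
      using bij_betw_imp_surj_on[OF rk] by (simp only: image_restrict_eq image_image[symmetric])
    moreover have "matches d k \<sigma> ?t"
      using f(2) rank_less_iff[OF finS[OF S]] by (subst matches_cong[of d k ?t f]) simp_all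
    ultimately have "?t \<in> order_types d k \<sigma> (card (f ` slot_ends))"
      unfolding order_types_def by blast
    then show "(f ` slot_ends, ?t) \<in> ?B" using S by blast
  next
    fix p assume "p \<in> ?B"
    then obtain S t where p: "p = (S, t)" and S: "S \<in> Pow {1..n}"
      and t: "t \<in> slot_ends \<rightarrow>\<^sub>E {1..card S}" "t ` slot_ends = {1..card S}" "matches d k \<sigma> t"
      by (auto simp: order_types_def)
    have t_in: "t z \<in> {1..card S}" if "z \<in> slot_ends" for z using PiE_mem[OF t(1) that] .
    let ?f = "\<lambda>z\<in>slot_ends. unrank S (t z)"
    have im: "?f ` slot_ends = S"
    proof -
      have "?f ` slot_ends = unrank S ` (t ` slot_ends)" by (simp add: image_image)
      then show ?thesis using unrank(2)[OF finS[OF S]] t(2) by simp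
    qed
    have "?f \<in> slot_ends \<rightarrow>\<^sub>E {1..n}"
    proof (intro restrict_PiE_iff[THEN iffD2] ballI)
      fix z assume "z \<in> slot_ends"
      from unrank(5)[OF finS[OF S] t_in[OF this]] show "unrank S (t z) \<in> {1..n}" using S by blast
    qed
    moreover have "matches d k \<sigma> ?f"
      using t(3) unrank_less_iff[OF finS[OF S] t_in t_in] by (subst matches_cong[of d k ?f t]) simp_all
    ultimately show "(case p of (S, t) \<Rightarrow> \<lambda>z\<in>slot_ends. unrank S (t z)) \<in> ?A" by (simp add: p)
    have "(\<lambda>z\<in>slot_ends. rank S (?f z)) = t"
    proof (rule ext)
      fix z
      show "(\<lambda>z\<in>slot_ends. rank S (?f z)) z = t z"
      proof (cases "z \<in> slot_ends")
        case True
        then show ?thesis using unrank(3)[OF finS[OF S] t_in[OF True]] by simp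
      next
        case False
        have "t \<in> extensional slot_ends" using t(1) by (simp add: PiE_def)
        from extensional_arb[OF this False] False show ?thesis by simp
      qed
    qed
    then show "((case p of (S, t) \<Rightarrow> \<lambda>z\<in>slot_ends. unrank S (t z)) ` slot_ends,
        \<lambda>z\<in>slot_ends. rank ((case p of (S, t) \<Rightarrow> \<lambda>z\<in>slot_ends. unrank S (t z)) ` slot_ends) ((case p of (S, t) \<Rightarrow> \<lambda>z\<in>slot_ends. unrank S (t z)) z)) = p"
      unfolding p prod.case im by simp
  qed
  also have "\<dots> = (\<Sum>S\<in>Pow {1..n}. \<Sum>t\<in>order_types d k \<sigma> (card S). C (\<lambda>z\<in>slot_ends. unrank S (t z)))"
    by (rule sum.Sigma[symmetric]) (auto simp: finite_order_types)
  finally show ?thesis .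
qed

text \<open>Since F is a class function, a term depends on the set S of points only through its size
  s, and (n choose s) (n - s)!/n! = 1/s! removes the dependence on n. Equivalently, 1/s! is the
  share of the increasing placements among all embeddings of {1..s}, each placement having the same
  weight.\<close>

lemma sum_prod_num_occ:
  assumes F: "\<And>\<tau> \<pi>. \<tau> \<in> Sym n \<Longrightarrow> \<pi> \<in> Sym n \<Longrightarrow> F (\<tau> \<circ> \<pi> \<circ> inv \<tau>) = F \<pi>"
  shows "(\<Sum>\<pi>\<in>Sym n. F \<pi> * of_nat (\<Prod>j=1..d. num_occ (k j) (\<sigma> j) n \<pi>)) / fact n
    = (\<Sum>s\<le>card slot_ends. \<Sum>t\<in>order_types d k \<sigma> s. 1 / fact s * emb_avg F n (Field (edges d k t)) (edges d k t))"
proof -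
  let ?A = "{f \<in> slot_ends \<rightarrow>\<^sub>E {1..n}. matches d k \<sigma> f}"
  let ?T = "order_types d k \<sigma>"
  let ?e = "\<lambda>t. emb_avg F n (Field (edges d k t)) (edges d k t)"
  have "finite (slot_ends \<rightarrow>\<^sub>E {1..n})" using finite_slots by (intro finite_PiE) auto
  then have finA: "finite ?A" by (rule rev_finite_subset) auto
  have FE: "Field (edges d k t) = {1..s}" if "t \<in> ?T s" for t s
    using that Field_edges[of d k t] by (simp add: order_types_def)
  have graph: "(\<Sum>\<pi> | \<pi> \<in> Sym n \<and> (\<forall>x\<in>slots d k. \<pi> ((\<lambda>z\<in>slot_ends. unrank S (t z)) (x, False)) = (\<lambda>z\<in>slot_ends. unrank S (t z)) (x, True)). F \<pi>)
      = fact (n - card S) * ?e t" if S: "S \<in> Pow {1..n}" and t: "t \<in> ?T (card S)" for S t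
  proof -
    have finS: "finite S" using S finite_subset by auto
    have "(\<Sum>\<pi> | \<pi> \<in> Sym n \<and> (\<forall>x\<in>slots d k. \<pi> ((\<lambda>z\<in>slot_ends. unrank S (t z)) (x, False)) = (\<lambda>z\<in>slot_ends. unrank S (t z)) (x, True)). F \<pi>)
      = graph_sum F n (edges d k t) (unrank S)"
      unfolding graph_sum_def edges_def by (intro sum.cong refl) auto
    moreover have "emb_avg F n {1..card S} (edges d k t)
        = graph_sum F n (edges d k t) (unrank S) / fact (n - card {1..card S})"
      using S unrank(1,2)[OF finS] FE[OF t] by (intro emb_avg_graph_sum[OF F]) auto
    ultimately show ?thesis by (simp add: FE[OF t])
  qed
  have "(\<Sum>\<pi>\<in>Sym n. F \<pi> * of_nat (\<Prod>j=1..d. num_occ (k j) (\<sigma> j) n \<pi>))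
      = (\<Sum>\<pi>\<in>Sym n. \<Sum>f | f \<in> ?A \<and> (\<forall>x\<in>slots d k. \<pi> (f (x, False)) = f (x, True)). F \<pi>)"
    by (intro sum.cong refl) (simp only: prod_num_occ sum_constant mult.commute)
  also have "\<dots> = (\<Sum>f\<in>?A. \<Sum>\<pi> | \<pi> \<in> Sym n \<and> (\<forall>x\<in>slots d k. \<pi> (f (x, False)) = f (x, True)). F \<pi>)"
    by (rule sum.swap_restrict[OF finite_Sym finA])
  also have "\<dots> = (\<Sum>S\<in>Pow {1..n}. \<Sum>t\<in>?T (card S). fact (n - card S) * ?e t)"
    unfolding sum_assignments by (intro sum.cong refl graph)
  also have "\<dots> = (\<Sum>s\<le>n. of_nat (n choose s) * (\<Sum>t\<in>?T s. fact (n - s) * ?e t))"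
    using sum_Pow_card[OF finite_atLeastAtMost, of "\<lambda>s. \<Sum>t\<in>?T s. fact (n - s) * ?e t" 1 n] by simp
  finally have "(\<Sum>\<pi>\<in>Sym n. F \<pi> * of_nat (\<Prod>j=1..d. num_occ (k j) (\<sigma> j) n \<pi>)) / fact n
      = (\<Sum>s\<le>n. of_nat (n choose s) * (\<Sum>t\<in>?T s. fact (n - s) * ?e t)) / fact n"
    by (rule arg_cong)
  also have "\<dots> = (\<Sum>s\<le>n. \<Sum>t\<in>?T s. 1 / fact s * ?e t)"
    unfolding sum_divide_distrib sum_distrib_left
    by (intro sum.cong refl) (simp add: binomial_fact)
  \<comment> \<open>The ranges s \<le> n and s \<le> \<open>card slot_ends\<close> are compared
    through a common larger one: beyond n there are no embeddings, beyond the number of slot ends no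
    order types.\<close>
  also have "\<dots> = (\<Sum>s\<le>n + card slot_ends. \<Sum>t\<in>?T s. 1 / fact s * ?e t)"
  proof (rule sum.mono_neutral_left)
    have e0: "?e t = 0" if "n < s" "t \<in> ?T s" for s t
      unfolding FE[OF that(2)] by (rule emb_avg_eq_0) (use that(1) in simp_all)
    show "\<forall>s\<in>{..n + card slot_ends} - {..n}. (\<Sum>t\<in>?T s. 1 / fact s * ?e t) = 0"
    proof
      fix s assume "s \<in> {..n + card slot_ends} - {..n}"
      then have "n < s" by simp
      from e0[OF this] show "(\<Sum>t\<in>?T s. 1 / fact s * ?e t) = 0" by (intro sum.neutral) simp
    qed
  qed simp_all
  also have "\<dots> = (\<Sum>s\<le>card slot_ends. \<Sum>t\<in>?T s. 1 / fact s * ?e t)"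
    by (rule sum.mono_neutral_right) (auto simp: order_types_empty)
  finally show ?thesis .
qed

lemma stably_poly_alpha:
  assumes "is_partition lam"
  shows "stably_poly lam (\<Sum>j=1..d. k j) (alpha lam d k \<sigma>)"
proof (rule stably_poly_cong)
  let ?F = "\<lambda>n. irr_char (pad_partition n lam)"
  let ?R = "\<lambda>n. \<Sum>s\<le>card slot_ends. \<Sum>t\<in>order_types d k \<sigma> s.
    1 / fact s * emb_avg (?F n) n (Field (edges d k t)) (edges d k t)"
  have fin: "finite (edges d k t)" and card: "card (edges d k t) \<le> (\<Sum>j=1..d. k j)" for t
    using finite_slots card_image_le[OF finite_slots[of d k]] by (auto simp: edges_def card_slots)
  show "stably_poly lam (\<Sum>j=1..d. k j) ?R"
    by (intro stably_poly_sum stably_poly_cmult stably_poly_mono[OF stably_poly_emb_avg[OF assms fin] card])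
  show "alpha lam d k \<sigma> n = ?R n" if "is_partition_of (pad_partition n lam) n" for n
  proof -
    have F: "?F n (\<tau> \<circ> \<pi> \<circ> inv \<tau>) = ?F n \<pi>" if "\<tau> \<in> Sym n" "\<pi> \<in> Sym n" for \<tau> \<pi>
      using irr_char_pad_conj[OF _ that] \<open>is_partition_of (pad_partition n lam) n\<close> by (simp add: is_partition_of_def)
    define G where "G = (\<lambda>\<rho>. \<Prod>j=1..d. of_nat (num_occ (k j) (\<sigma> j) n \<rho>) :: complex)"
    \<comment> \<open>The complex conjugation in \<open>class_inner\<close> disappears because the
      pattern averages are rational.\<close>
    have "alpha lam d k \<sigma> n
        = (\<Sum>\<pi>\<in>Sym n. ?F n \<pi> * ((\<Sum>\<rho>\<in>conj_class n \<pi>. G \<rho>) / of_nat (card (conj_class n \<pi>)))) / fact n"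
      unfolding alpha_def class_inner_def pattern_avg_def G_def by simp
    also have "\<dots> = (\<Sum>\<pi>\<in>Sym n. ?F n \<pi> * G \<pi>) / fact n"
      using sum_conj_class_average[where F = "?F n" and G = G, OF F] by simp
    also have "\<dots> = ?R n"
      unfolding G_def of_nat_prod[symmetric] by (rule sum_prod_num_occ[where F = "?F n", OF F])
    finally show ?thesis .
  qed
qed

end

theorem theorem1p3:
  fixes d K :: nat and k :: "nat \<Rightarrow> nat" and \<sigma> :: "nat \<Rightarrow> nat \<Rightarrow> nat" and lam :: "nat list"
  assumes "\<And>j. j \<in> {1..d} \<Longrightarrow> \<sigma> j \<in> Sym (k j)"
    and "K = (\<Sum>j=1..d. k j)"
    and "is_partition lam"
  shows "\<exists>a :: complex poly.
           (a \<noteq> 0 \<longrightarrow> int (degree a) \<le> int K - int (sum_list lam)) \<and>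
           (\<forall>n \<ge> K + sum_list lam. is_partition_of (pad_partition n lam) n \<longrightarrow>
              alpha lam d k \<sigma> n = poly a (of_nat n)) \<and>
           (sum_list lam > K \<longrightarrow>
              a = 0 \<and>
              (\<forall>n \<ge> K + sum_list lam. is_partition_of (pad_partition n lam) n \<longrightarrow>
                 alpha lam d k \<sigma> n = 0))"
proof -
  have "stably_poly lam K (alpha lam d k \<sigma>)"
    unfolding assms(2) by (rule stably_poly_alpha[OF assms(3)])
  then obtain a where deg: "a \<noteq> 0 \<longrightarrow> degree a + sum_list lam \<le> K"
    and a: "\<forall>n \<ge> K + sum_list lam. is_partition_of (pad_partition n lam) n \<longrightarrow> alpha lam d k \<sigma> n = poly a (of_nat n)"
    unfolding stably_poly_def by blast
  show ?thesis
  proof (intro exI[of _ a] conjI impI)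
    show "int (degree a) \<le> int K - int (sum_list lam)" if "a \<noteq> 0" using deg that by simp
    assume "sum_list lam > K"
    then show "a = 0" using deg by auto
    then show "\<forall>n \<ge> K + sum_list lam. is_partition_of (pad_partition n lam) n \<longrightarrow> alpha lam d k \<sigma> n = 0"
      using a by simp
  qed (rule a)
qed

end
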